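(* Fix $L\ge 20$. For any pattern $(\mathbf a,\mathbf e)$ there exists $S\subseteq V(\Gamma)$ such that \[p((\mathbf a,\mathbf e)_S)\ge p(\mathbf a,\mathbf e)-150L\sqrt d\] and, for $G$ a random $n$-lift of $H$, \[\mathbb{P}\big((\mathbf a,\mathbf e)_S\text{ can be found in }G\big)\le C\prod_{(i,w)\in S,\,a_{i,w}>0}a_{i,w}^{d/4}\Big(\prod_{(i,w)\in S,\,a_{i,w}>0}\binom{n}{\min(a_{i,w},\lfloor n/2\rfloor)}\Big)^{1-L/10},\] where $C$ is a constant not depending on $n$ or on the pattern.
   Context: $d\ge2$ and $H$ is a $d$-regular graph on $[h]$. A random $n$-lift $G$ of $H$ has vertex set $\{(i,j):i\in[h],j\in[n]\}$, fibres $V_i=\{(i,j):j\in[n]\}$, and for each $ii'\in E(H)$ an independent uniformly random perfect matching between $V_i$ and $V_{i'}$ (no other edges). $D^{>0}=\{2^k/\sqrt{nh}:k\in\mathbb{Z},k\ge0\}$; $\Gamma$ is the graph on $[h]\times D^{>0}$ with $(i,w)\sim_\Gamma(i',w')$ iff $ii'\in E(H)$ and $w/w'\in(d^{-1/2},d^{1/2})$. A pattern is $(\mathbf a,\mathbf e)$: nonnegative integers $a_{i,w}$ with $\sum_wa_{i,w}\le n$ for each $i$, $\sum w^2a_{i,w}\le10$, some $w_0\in D^{>0}$ with $a_{i,w}=0$ unless $w_0\le w\le dw_0$; integers $e_{i,w,i',w'}$ for edges of $\Gamma$ (symmetric) with $0\le e\le\min(a_{i,w},a_{i',w'})$. It can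 be found in $G$ if there are pairwise disjoint $A_{i,w}\subseteq V_i$ with $|A_{i,w}|=a_{i,w}$ and exactly $e_{i,w,i',w'}$ edges of $G$ between $A_{i,w}$ and $A_{i',w'}$ for each edge of $\Gamma$. Potency $p(\mathbf a,\mathbf e)=|\sum_{(i,w)(i',w')\in E(\Gamma)}ww'(e_{i,w,i',w'}-a_{i,w}a_{i',w'}/n)|$. Sub-pattern $(\mathbf a,\mathbf e)_S$: keep $a_{i,w}$ for $(i,w)\in S$ (else $0$) and $e$ on edges with both ends in $S$ (else $0$). *)

theory Defs
  imports "HOL-Probability.Probability" "HOL-Combinatorics.Permutations"
begin

definition regular_graph :: "nat \<Rightarrow> nat \<Rightarrow> (nat \<Rightarrow> nat \<Rightarrow> bool) \<Rightarrow> bool" where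
  "regular_graph d h adjH \<longleftrightarrow>
     (\<forall>i i'. adjH i i' \<longrightarrow> i < h \<and> i' < h \<and> i \<noteq> i') \<and>
     (\<forall>i i'. adjH i i' \<longleftrightarrow> adjH i' i) \<and>
     (\<forall>i<h. card {i'. adjH i i'} = d)"

text \<open>The weight w = 2^k / sqrt(n h) in D^{>0} is encoded by the exponent k :: nat.
Vertices of Gamma are pairs (i,k).\<close>
definition wt :: "nat \<Rightarrow> nat \<Rightarrow> nat \<Rightarrow> real" where
  "wt n h k = 2 ^ k / sqrt (real n * real h)"

definition Gamma_adj :: "nat \<Rightarrow> nat \<Rightarrow> nat \<Rightarrow> (nat \<Rightarrow> nat \<Rightarrow> bool) \<Rightarrow> nat \<times> nat \<Rightarrow> nat \<times> nat \<Rightarrow> bool" where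
  "Gamma_adj d n h adjH x y \<longleftrightarrow>
     adjH (fst x) (fst y) \<and>
     wt n h (snd x) / wt n h (snd y) \<in> {1 / sqrt (real d) <..< sqrt (real d)}"

definition supp :: "(nat \<times> nat \<Rightarrow> nat) \<Rightarrow> (nat \<times> nat) set" where
  "supp a = {x. a x > 0}"

text \<open>Patterns (a, e): a (i,k) = a_{i,w}, e x y = e_{x,y} (only values on edges of Gamma matter).\<close>
definition is_pattern :: "nat \<Rightarrow> nat \<Rightarrow> nat \<Rightarrow> (nat \<Rightarrow> nat \<Rightarrow> bool) \<Rightarrow>
    (nat \<times> nat \<Rightarrow> nat) \<Rightarrow> (nat \<times> nat \<Rightarrow> nat \<times> nat \<Rightarrow> nat) \<Rightarrow> bool" where
  "is_pattern d n h adjH a e \<longleftrightarrow>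
     (\<forall>i k. i \<ge> h \<longrightarrow> a (i, k) = 0) \<and>
     (\<exists>k0. \<forall>i k. a (i, k) \<noteq> 0 \<longrightarrow> wt n h k0 \<le> wt n h k \<and> wt n h k \<le> real d * wt n h k0) \<and>
     (\<forall>i<h. (\<Sum>k\<in>{k. (i, k) \<in> supp a}. a (i, k)) \<le> n) \<and>
     (\<Sum>x\<in>supp a. (wt n h (snd x))\<^sup>2 * real (a x)) \<le> 10 \<and>
     (\<forall>x y. Gamma_adj d n h adjH x y \<longrightarrow> e x y = e y x \<and> e x y \<le> min (a x) (a y))"

text \<open>Potency: sum over the (unordered) edges of Gamma, written as half the sum over
ordered adjacent pairs; only edges with both ends in the support of a can contribute
(for patterns e vanishes on the other edges).\<close>
definition potency :: "nat \<Rightarrow> nat \<Rightarrow> nat \<Rightarrow> (nat \<Rightarrow> nat \<Rightarrow> bool) \<Rightarrow>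
    (nat \<times> nat \<Rightarrow> nat) \<Rightarrow> (nat \<times> nat \<Rightarrow> nat \<times> nat \<Rightarrow> nat) \<Rightarrow> real" where
  "potency d n h adjH a e =
     \<bar>(1/2) * (\<Sum>(x, y)\<in>{(x, y). x \<in> supp a \<and> y \<in> supp a \<and> Gamma_adj d n h adjH x y}.
        wt n h (snd x) * wt n h (snd y) * (real (e x y) - real (a x) * real (a y) / real n))\<bar>"

definition sub_a :: "(nat \<times> nat) set \<Rightarrow> (nat \<times> nat \<Rightarrow> nat) \<Rightarrow> (nat \<times> nat \<Rightarrow> nat)" where
  "sub_a S a = (\<lambda>x. if x \<in> S then a x else 0)"

definition sub_e :: "(nat \<times> nat) set \<Rightarrow> (nat \<times> nat \<Rightarrow> nat \<times> nat \<Rightarrow> nat) \<Rightarrow> (nat \<times> nat \<Rightarrow> nat \<times> nat \<Rightarrow> nat)" where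
  "sub_e S e = (\<lambda>x y. if x \<in> S \<and> y \<in> S then e x y else 0)"

text \<open>Random n-lift: for each edge {i,i'} of H with i < i', a permutation sigma(i,i') of
{0..<n}; vertex (i,j) is joined to (i', sigma(i,i') j). A uniformly random permutation is a
uniformly random perfect matching between V_i and V_i'; choices are independent.\<close>
definition lift_space :: "nat \<Rightarrow> (nat \<Rightarrow> nat \<Rightarrow> bool) \<Rightarrow> ((nat \<times> nat) \<Rightarrow> nat \<Rightarrow> nat) set" where
  "lift_space n adjH = PiE {(i, i'). adjH i i' \<and> i < i'} (\<lambda>_. {f. f permutes {0..<n}})"

definition lift_adj :: "(nat \<Rightarrow> nat \<Rightarrow> bool) \<Rightarrow> ((nat \<times> nat) \<Rightarrow> nat \<Rightarrow> nat) \<Rightarrow> nat \<times> nat \<Rightarrow> nat \<times> nat \<Rightarrow> bool" where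
  "lift_adj adjH \<sigma> u v \<longleftrightarrow> adjH (fst u) (fst v) \<and>
     (if fst u < fst v then \<sigma> (fst u, fst v) (snd u) = snd v
      else \<sigma> (fst v, fst u) (snd v) = snd u)"

text \<open>A_{i,w} \<subseteq> V_i is encoded by A (i,k) \<subseteq> {0..<n} (the second coordinates).\<close>
definition found_in :: "nat \<Rightarrow> nat \<Rightarrow> nat \<Rightarrow> (nat \<Rightarrow> nat \<Rightarrow> bool) \<Rightarrow>
    (nat \<times> nat \<Rightarrow> nat) \<Rightarrow> (nat \<times> nat \<Rightarrow> nat \<times> nat \<Rightarrow> nat) \<Rightarrow> ((nat \<times> nat) \<Rightarrow> nat \<Rightarrow> nat) \<Rightarrow> bool" where
  "found_in d n h adjH a e \<sigma> \<longleftrightarrow>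
     (\<exists>A :: nat \<times> nat \<Rightarrow> nat set.
        (\<forall>x. A x \<subseteq> {0..<n} \<and> card (A x) = a x) \<and>
        (\<forall>i k k'. k \<noteq> k' \<longrightarrow> A (i, k) \<inter> A (i, k') = {}) \<and>
        (\<forall>x y. Gamma_adj d n h adjH x y \<longrightarrow>
           card {(j, j'). j \<in> A x \<and> j' \<in> A y \<and> lift_adj adjH \<sigma> (fst x, j) (fst y, j')} = e x y))"

definition prob_found :: "nat \<Rightarrow> nat \<Rightarrow> nat \<Rightarrow> (nat \<Rightarrow> nat \<Rightarrow> bool) \<Rightarrow>
    (nat \<times> nat \<Rightarrow> nat) \<Rightarrow> (nat \<times> nat \<Rightarrow> nat \<times> nat \<Rightarrow> nat) \<Rightarrow> real" where
  "prob_found d n h adjH a e =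
     measure_pmf.prob (pmf_of_set (lift_space n adjH)) {\<sigma>. found_in d n h adjH a e \<sigma>}"

end

theory Submission
  imports Defs
begin

text \<open>
  Write \<open>\<mu> = a\<^sub>x a\<^sub>y / n\<close>, \<open>I(e, \<mu>) = e ln (e / \<mu>) - e + \<mu>\<close> and \<open>l\<^sub>x = 1 + ln (n / a\<^sub>x)\<close>. Starting from the
  support of the pattern, delete a vertex \<open>x\<close> of \<open>\<Gamma>\<close> as long as its remaining edges have total rate
  \<open>\<Sum>\<^sub>y I(e\<^sub>x\<^sub>y, \<mu>\<^sub>x\<^sub>y)\<close> below \<open>(L / 4) a\<^sub>x l\<^sub>x\<close>.

  A deletion costs little potency. Edges with \<open>e > exp (1 + l\<^sub>x / 4) \<mu>\<close> satisfy \<open>e \<le> 4 I / l\<^sub>x\<close>, and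
  \<open>w\<^sub>y \<le> \<surd>d w\<^sub>x\<close>, so they lose at most \<open>L \<surd>d w\<^sub>x\<^sup>2 a\<^sub>x\<close>. For the others
  \<open>(e - \<mu>)\<^sup>2 \<le> 2 I max(e, \<mu>)\<close> and Cauchy--Schwarz bound the loss, up to constants, by
  \<open>\<surd>(L T) w\<^sub>x \<surd>a\<^sub>x (a\<^sub>x / n)\<^sup>1\<^sup>/\<^sup>4\<close>, where \<open>T\<close> is the mass \<open>\<Sum> w\<^sup>2 a\<close> of the neighbouring fibres; since
  the weights are dyadic, these terms sum geometrically inside each fibre.

  After the deletions the rates of all edges sum to at least \<open>(L / 8) \<Sum> a\<^sub>x l\<^sub>x\<close>, and \<open>a\<^sub>x l\<^sub>x\<close> dominates
  the logarithm of the binomial coefficient. For fixed sets \<open>A\<^sub>x\<close> the edge counts have probability at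
  most \<open>exp (- \<Sum> I)\<close> up to a polynomial in the \<open>a\<^sub>x\<close>: colour \<open>V\<^sub>i'\<close> by the sets it contains; pulling the
  colouring back along a uniform permutation gives a uniform colouring with prescribed class sizes,
  which is an independent colouring conditioned on an event of polynomially large probability. The
  polynomial factors are absorbed by the slack between \<open>L / 8\<close> and \<open>L / 10\<close>.
\<close>

section \<open>Permutations with prescribed edge counts\<close>

lemma power_self_Suc_le: "real (Suc n) ^ n \<le> exp 1 * real n ^ n"
proof (cases "n = 0")
  case False
  then have "(1 + 1 / real n) ^ n \<le> exp 1"
    using exp_ge_one_plus_x_over_n_power_n[of n 1] by simp
  then have "(1 + 1 / real n) ^ n * real n ^ n \<le> exp 1 * real n ^ n"
    by (intro mult_right_mono) auto
  also have "(1 + 1 / real n) ^ n * real n ^ n = real (Suc n) ^ n"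
    using False by (simp flip: power_mult_distrib add: field_simps)
  finally show ?thesis .
qed simp

lemma exp_power_self_le: "exp 1 * real n ^ Suc n \<le> real (Suc n) ^ Suc n"
proof -
  have "(1 + (-1) / real (Suc n)) ^ Suc n \<le> exp (-1)"
    using exp_ge_one_plus_x_over_n_power_n[of "Suc n" "-1"] by simp
  moreover have "1 + (-1) / real (Suc n) = real n / real (Suc n)"
    by (simp add: field_simps)
  ultimately have "real n ^ Suc n / real (Suc n) ^ Suc n \<le> exp (-1)"
    by (simp add: power_divide del: power_Suc of_nat_Suc)
  then have "real n ^ Suc n \<le> exp (-1) * real (Suc n) ^ Suc n"
    by (simp add: pos_divide_le_eq del: power_Suc of_nat_Suc)
  then have "exp 1 * real n ^ Suc n \<le> exp 1 * (exp (-1) * real (Suc n) ^ Suc n)"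
    by (intro mult_left_mono) auto
  also have "\<dots> = real (Suc n) ^ Suc n"
    by (simp add: exp_minus del: power_Suc of_nat_Suc)
  finally show ?thesis .
qed

lemma exp_of_nat_Suc_eq: "exp (real (Suc n)) = exp (real n) * exp 1"
  by (simp flip: exp_add)

text \<open>By Stirling's formula this grows like \<open>sqrt (2 * pi * n)\<close>. For
  \<open>n \<ge> 1\<close> the ratio of consecutive values is \<open>e / (1 + 1 / n) ^ n\<close>,
  which the two inequalities above place between \<open>1\<close> and \<open>1 + 1 / n\<close>. The
  value at \<open>0\<close> is \<open>1\<close>, since \<open>0 ^ 0 = 1\<close>.\<close>

definition stirling_quot :: "nat \<Rightarrow> real" where
  "stirling_quot n = fact n * exp (real n) / real n ^ n"

lemma stirling_quot_pos: "stirling_quot n > 0"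
  by (cases "n = 0") (auto simp: stirling_quot_def)

lemma stirling_quot_mono: "m \<le> n \<Longrightarrow> stirling_quot m \<le> stirling_quot n"
proof (induction n rule: dec_induct)
  case (step n)
  have "real n ^ n > 0" by (cases "n = 0") auto
  have "stirling_quot (Suc n) = fact n * exp (real n) * (exp 1 / real (Suc n) ^ n)"
    unfolding stirling_quot_def fact_Suc of_nat_mult of_nat_fact exp_of_nat_Suc_eq power_Suc
    by (simp del: of_nat_Suc)
  also have "\<dots> \<ge> fact n * exp (real n) * (1 / real n ^ n)"
    using power_self_Suc_le[of n] \<open>real n ^ n > 0\<close>
    by (intro mult_left_mono) (simp_all add: divide_simps)
  finally show ?case
    using step.IH by (simp add: stirling_quot_def)
qed simp

lemma stirling_quot_le: "n \<ge> 1 \<Longrightarrow> stirling_quot n \<le> exp 1 * real n"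
proof (induction n rule: dec_induct)
  case base
  then show ?case by (simp add: stirling_quot_def)
next
  case (step n)
  have n: "real n ^ n > 0" "real n > 0" using step by auto
  have "stirling_quot (Suc n) = stirling_quot n * (exp 1 * real n ^ n / real (Suc n) ^ n)"
    unfolding stirling_quot_def fact_Suc of_nat_mult of_nat_fact exp_of_nat_Suc_eq power_Suc
    using n by (simp del: of_nat_Suc)
  also have "\<dots> \<le> (exp 1 * real n) * (exp 1 * real n ^ n / real (Suc n) ^ n)"
    using step by (intro mult_right_mono) auto
  also have "\<dots> = exp 1 * ((exp 1 * real n ^ Suc n) / real (Suc n) ^ n)"
    by (simp add: field_simps)
  also have "\<dots> \<le> exp 1 * (real (Suc n) ^ Suc n / real (Suc n) ^ n)"
    using exp_power_self_le[of n] by (intro mult_left_mono divide_right_mono) auto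
  also have "\<dots> = exp 1 * real (Suc n)"
    by simp
  finally show ?case .
qed

section \<open>Uniform permutations seen as colourings\<close>

lemma card_permutes_preserving_le:
  assumes "finite A" "finite Q" "s ` A \<subseteq> Q"
  shows "card {p. p permutes A \<and> (\<forall>x\<in>A. s (p x) = s x)} \<le> (\<Prod>c\<in>Q. fact (card {x\<in>A. s x = c}))"
proof -
  let ?F = "\<lambda>c. {x\<in>A. s x = c}"
  let ?P = "{p. p permutes A \<and> (\<forall>x\<in>A. s (p x) = s x)}"
  \<comment> \<open>A colour-preserving permutation is determined by its restrictions to the colour
    classes. Each restriction is extended by the identity, so that it permutes its class.\<close>
  define \<Phi> where "\<Phi> = (\<lambda>p. \<lambda>c\<in>Q. (\<lambda>x. if x \<in> ?F c then p x else x))"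
  have "inj_on \<Phi> ?P"
  proof (rule inj_onI)
    fix p q assume pq: "p \<in> ?P" "q \<in> ?P" "\<Phi> p = \<Phi> q"
    show "p = q"
    proof
      fix x show "p x = q x"
      proof (cases "x \<in> A")
        case True
        then have "s x \<in> Q" using assms by auto
        then have "\<Phi> p (s x) x = p x" "\<Phi> q (s x) x = q x"
          using True by (auto simp: \<Phi>_def)
        then show ?thesis using pq by simp
      qed (use pq in \<open>auto simp: permutes_def\<close>)
    qed
  qed
  moreover have "\<Phi> ` ?P \<subseteq> PiE Q (\<lambda>c. {p. p permutes ?F c})"
  proof (clarsimp simp: \<Phi>_def)
    fix p c assume p: "p permutes A" "\<forall>x\<in>A. s (p x) = s x" and "c \<in> Q"
    have inj: "inj_on p A" using p permutes_inj_on by blast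
    have "p ` ?F c \<subseteq> ?F c" using p permutes_in_image[OF p(1)] by auto
    then have "p ` ?F c = ?F c"
      using assms inj by (intro endo_inj_surj) (auto intro: inj_on_subset)
    moreover have "inj_on p (?F c)" using inj by (rule inj_on_subset) auto
    ultimately have "bij_betw p (?F c) (?F c)" by (simp add: bij_betw_def)
    then have "bij_betw (\<lambda>x. if x \<in> A \<and> s x = c then p x else x) (?F c) (?F c)"
      by (rule bij_betw_cong[THEN iffD1, rotated]) auto
    then show "(\<lambda>x. if x \<in> A \<and> s x = c then p x else x) permutes ?F c"
      by (rule bij_imp_permutes) auto
  qed
  moreover have "finite (PiE Q (\<lambda>c. {p. p permutes ?F c}))"
    using assms by (intro finite_PiE) (auto intro: finite_permutations)
  ultimately have "card ?P \<le> card (PiE Q (\<lambda>c. {p. p permutes ?F c}))"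
    by (intro card_inj_on_le)
  also have "\<dots> = (\<Prod>c\<in>Q. fact (card (?F c)))"
    using assms by (subst card_PiE) (auto intro!: prod.cong card_permutations)
  finally show ?thesis .
qed

text \<open>
  Each colouring of the form \<open>s \<circ> \<sigma>\<close> arises from at most \<open>\<Prod> b\<^sub>c!\<close> permutations; after that the
  restriction on the class sizes is dropped and the sum over all colourings factorises.
\<close>
lemma sum_permutes_le:
  fixes t :: "nat \<Rightarrow> 'c \<Rightarrow> real"
  assumes Q: "finite Q" "s ` {0..<n} \<subseteq> Q" and t: "\<And>j c. t j c \<ge> 0"
  defines "b \<equiv> \<lambda>c. card {k\<in>{0..<n}. s k = c}"
  shows "(\<Sum>\<sigma> | \<sigma> permutes {0..<n}. \<Prod>j<n. t j (s (\<sigma> j)))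
     \<le> (\<Prod>c\<in>Q. fact (b c) / real (b c) ^ b c) * (\<Prod>j<n. \<Sum>c\<in>Q. real (b c) * t j c)"
proof -
  let ?N = "{0..<n}"
  let ?P = "{\<sigma>. \<sigma> permutes ?N}"
  define col where "col = (\<lambda>\<sigma>. \<lambda>j\<in>?N. s (\<sigma> j))"
  define F where "F = (\<lambda>g. \<Prod>j<n. t j (g j))"
  define K where "K = (\<Prod>c\<in>Q. fact (b c) :: real)"
  define M where "M = (\<Prod>c\<in>Q. real (b c) ^ b c)"
  have finP: "finite ?P" by (intro finite_permutations) auto
  \<comment> \<open>Empty classes contribute \<open>0 ^ 0 = 1\<close>, so \<open>M\<close> can be
    divided by.\<close>
  have M: "M > 0" unfolding M_def by (intro prod_pos) (metis of_nat_0_less_iff power_0 zero_less_one zero_less_power neq0_conv)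
  have F0: "F g \<ge> 0" for g unfolding F_def by (intro prod_nonneg) (auto simp: t)
  have fib: "real (card {\<sigma>\<in>?P. col \<sigma> = g}) \<le> K" for g
  proof (cases "{\<sigma>\<in>?P. col \<sigma> = g} = {}")
    case False
    then obtain \<tau> where \<tau>: "\<tau> permutes ?N" "col \<tau> = g" by auto
    \<comment> \<open>Composition with the inverse of a fixed member \<open>\<tau>\<close> of the
      fibre injects the fibre into the permutations that preserve \<open>s\<close>.\<close>
    have "card {\<sigma>\<in>?P. col \<sigma> = g} \<le> card {p. p permutes ?N \<and> (\<forall>x\<in>?N. s (p x) = s x)}"
    proof (rule card_inj_on_le[where f = "\<lambda>\<sigma>. \<sigma> \<circ> inv \<tau>"])
      show "inj_on (\<lambda>\<sigma>. \<sigma> \<circ> inv \<tau>) {\<sigma>\<in>?P. col \<sigma> = g}"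
      proof (rule inj_onI)
        fix p q assume "p \<circ> inv \<tau> = q \<circ> inv \<tau>"
        then have "p \<circ> inv \<tau> \<circ> \<tau> = q \<circ> inv \<tau> \<circ> \<tau>" by simp
        then show "p = q"
          using permutes_inv_o(2)[OF \<tau>(1)] by (simp add: comp_assoc)
      qed
      show "(\<lambda>\<sigma>. \<sigma> \<circ> inv \<tau>) ` {\<sigma>\<in>?P. col \<sigma> = g} \<subseteq> {p. p permutes ?N \<and> (\<forall>x\<in>?N. s (p x) = s x)}"
      proof safe
        fix \<sigma> assume \<sigma>: "\<sigma> permutes ?N" "g = col \<sigma>"
        show "\<sigma> \<circ> inv \<tau> permutes ?N"
          using \<sigma> \<tau> permutes_compose permutes_inv by blast
        fix x assume x: "x \<in> ?N"
        then have x': "inv \<tau> x \<in> ?N" using permutes_in_image[OF permutes_inv[OF \<tau>(1)]] by blast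
        have "col \<sigma> (inv \<tau> x) = col \<tau> (inv \<tau> x)" using \<sigma> \<tau> by simp
        then show "s ((\<sigma> \<circ> inv \<tau>) x) = s x"
          using x' permutes_inverses[OF \<tau>(1)] by (simp add: col_def)
      qed
    qed (simp add: finite_permutations)
    also have "\<dots> \<le> (\<Prod>c\<in>Q. fact (b c))"
      unfolding b_def using Q by (intro card_permutes_preserving_le) auto
    finally have "real (card {\<sigma>\<in>?P. col \<sigma> = g}) \<le> real (\<Prod>c\<in>Q. fact (b c))"
      by (simp only: of_nat_le_iff)
    then show ?thesis by (simp add: K_def)
  next
    case True
    show ?thesis unfolding True K_def by (auto intro!: prod_nonneg)
  qed
  \<comment> \<open>Every realised colouring uses each colour \<open>c\<close> exactly
    \<open>b c\<close> times, so this product is the same constant for all of them and can be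
    inserted under the sum.\<close>
  have weight: "(\<Prod>j<n. real (b (g j))) = M" if g: "g \<in> col ` ?P" for g
  proof -
    obtain \<sigma> where \<sigma>: "\<sigma> permutes ?N" "g = col \<sigma>" using g by auto
    have "(\<Prod>j<n. real (b (g j))) = (\<Prod>j\<in>?N. (\<lambda>k. real (b (s k))) (\<sigma> j))"
      using \<sigma> by (intro prod.cong) (auto simp: col_def)
    also have "\<dots> = (\<Prod>k\<in>?N. real (b (s k)))"
      using permutes_imp_bij[OF \<sigma>(1)] by (rule prod.reindex_bij_betw)
    also have "\<dots> = (\<Prod>c\<in>Q. \<Prod>k\<in>{k\<in>?N. s k = c}. real (b (s k)))"
      using Q by (intro prod.group[symmetric]) auto
    also have "\<dots> = M" unfolding M_def
      by (intro prod.cong) (auto simp: b_def)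
    finally show ?thesis .
  qed
  have "(\<Sum>\<sigma>\<in>?P. \<Prod>j<n. t j (s (\<sigma> j))) = (\<Sum>\<sigma>\<in>?P. F (col \<sigma>))"
    by (intro sum.cong) (auto simp: F_def col_def)
  also have "\<dots> = (\<Sum>g\<in>col ` ?P. \<Sum>\<sigma>\<in>{\<sigma>\<in>?P. col \<sigma> = g}. F (col \<sigma>))"
    using finP by (rule sum.image_gen)
  also have "\<dots> = (\<Sum>g\<in>col ` ?P. real (card {\<sigma>\<in>?P. col \<sigma> = g}) * F g)"
    by (intro sum.cong) auto
  also have "\<dots> \<le> (\<Sum>g\<in>col ` ?P. K * F g)"
    by (intro sum_mono mult_right_mono fib F0)
  also have "\<dots> = K / M * (\<Sum>g\<in>col ` ?P. M * F g)"
    using M by (simp add: sum_distrib_left)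
  also have "(\<Sum>g\<in>col ` ?P. M * F g) = (\<Sum>g\<in>col ` ?P. \<Prod>j<n. real (b (g j)) * t j (g j))"
    by (intro sum.cong) (auto simp: prod.distrib F_def weight)
  also have "\<dots> \<le> (\<Sum>g\<in>PiE {..<n} (\<lambda>_. Q). \<Prod>j<n. real (b (g j)) * t j (g j))"
  proof (rule sum_mono2)
    show "finite (PiE {..<n} (\<lambda>_. Q))" using Q by (intro finite_PiE) auto
    show "col ` ?P \<subseteq> PiE {..<n} (\<lambda>_. Q)"
    proof (rule image_subsetI)
      fix \<sigma> assume "\<sigma> \<in> ?P"
      then show "col \<sigma> \<in> PiE {..<n} (\<lambda>_. Q)"
        unfolding col_def using Q permutes_in_image[of \<sigma> ?N] by (auto simp: lessThan_atLeast0)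
    qed
  qed (intro prod_nonneg, auto simp: t)
  also have "\<dots> = (\<Prod>j<n. \<Sum>c\<in>Q. real (b c) * t j c)"
    using Q by (subst prod_sum_PiE) auto
  finally have "(\<Sum>\<sigma>\<in>?P. \<Prod>j<n. t j (s (\<sigma> j))) \<le> K / M * (\<Prod>j<n. \<Sum>c\<in>Q. real (b c) * t j c)"
    using M by (simp add: K_def prod_nonneg mult_left_mono divide_right_mono)
  then show ?thesis unfolding K_def M_def by (simp add: prod_dividef)
qed

text \<open>Large-deviation rate of a Poisson variable with mean \<open>\<mu>\<close> at the value
  \<open>e\<close>. At \<open>e = 0\<close> the first term vanishes and the rate is
  \<open>\<mu>\<close>.\<close>

definition rate :: "real \<Rightarrow> real \<Rightarrow> real" where
  "rate e \<mu> = e * ln (e / \<mu>) - e + \<mu>"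

text \<open>With \<open>k! / k ^ k = stirling_quot k * exp (- k)\<close> the exponentials on both
  sides agree. The leftover class of size \<open>m\<close> is absorbed by monotonicity of
  \<open>stirling_quot\<close>; only the classes in \<open>Y\<close> cost a linear factor
  each.\<close>

lemma prod_fact_quot_le:
  assumes "finite Y" "\<And>y. y \<in> Y \<Longrightarrow> b y \<ge> 1"
  shows "fact m / real m ^ m * (\<Prod>y\<in>Y. fact (b y) / real (b y) ^ b y)
    \<le> fact (m + sum b Y) / real (m + sum b Y) ^ (m + sum b Y) * (\<Prod>y\<in>Y. exp 1 * real (b y))"
proof -
  let ?n = "m + sum b Y"
  have quot: "fact k / real k ^ k = stirling_quot k * exp (- real k)" for k
    by (simp add: stirling_quot_def exp_minus)
  have "(\<Prod>y\<in>Y. exp (- real (b y))) = exp (- real (sum b Y))"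
    using assms(1) by (simp add: exp_sum flip: sum_negf)
  moreover have "exp (- real m) * exp (- real (sum b Y)) = exp (- real ?n)"
    by (simp flip: exp_add)
  ultimately have "fact m / real m ^ m * (\<Prod>y\<in>Y. fact (b y) / real (b y) ^ b y)
     = stirling_quot m * exp (- real ?n) * (\<Prod>y\<in>Y. stirling_quot (b y))"
    unfolding quot prod.distrib by (simp only: mult.assoc mult.commute mult.left_commute)
  also have "\<dots> \<le> stirling_quot ?n * exp (- real ?n) * (\<Prod>y\<in>Y. exp 1 * real (b y))"
    using assms(2)
    by (intro mult_mono mult_right_mono prod_mono stirling_quot_mono)
      (auto intro!: stirling_quot_le less_imp_le[OF stirling_quot_pos] mult_nonneg_nonneg prod_nonneg)
  finally show ?thesis unfolding quot by (simp add: mult_ac)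
qed

text \<open>At most one factor differs from \<open>1\<close>, so expanding the product leaves no
  mixed terms. This turns the colour average of the tilted weight into a sum over pairs.\<close>

lemma prod_single_factor:
  fixes f :: "'a \<Rightarrow> real"
  assumes "finite E" "\<And>p q. p \<in> E \<Longrightarrow> q \<in> E \<Longrightarrow> P p \<Longrightarrow> P q \<Longrightarrow> p = q"
  shows "(\<Prod>p\<in>E. if P p then f p else 1) = 1 + (\<Sum>p\<in>E. if P p then f p - 1 else 0)"
proof (cases "\<exists>p\<in>E. P p")
  case True
  then obtain p where p: "p \<in> E" "P p" by auto
  have "(\<Prod>q\<in>E. if P q then f q else 1) = (\<Prod>q\<in>E. if q = p then f q else 1)"
    using p assms by (intro prod.cong) auto
  moreover have "(\<Sum>q\<in>E. if P q then f q - 1 else 0) = (\<Sum>q\<in>E. if q = p then f q - 1 else 0)"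
    using p assms by (intro sum.cong) auto
  ultimately show ?thesis using p assms(1) by simp
qed auto

text \<open>
  Exponential Markov inequality with the optimal tilt \<open>\<tau> = e / \<mu>\<close>. An entry \<open>e = 0\<close> is covered because
  \<open>0 ^ 0 = 1\<close> on one side and \<open>0 * ln 0 = 0\<close> on the other.
\<close>
lemma card_permutes_prescribed_counts_le:
  fixes A :: "'x \<Rightarrow> nat set" and B :: "'y \<Rightarrow> nat set" and e :: "'x \<Rightarrow> 'y \<Rightarrow> nat"
  assumes n: "n \<ge> 1"
    and X: "finite X" "disjoint_family_on A X" "\<And>x. x \<in> X \<Longrightarrow> A x \<subseteq> {0..<n} \<and> A x \<noteq> {}"
    and Y: "finite Y" "disjoint_family_on B Y" "\<And>y. y \<in> Y \<Longrightarrow> B y \<subseteq> {0..<n} \<and> B y \<noteq> {}"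
    and E: "E \<subseteq> X \<times> Y"
  shows "real (card {\<sigma>. \<sigma> permutes {0..<n} \<and> (\<forall>(x, y)\<in>E. card {j\<in>A x. \<sigma> j \<in> B y} = e x y)})
    \<le> fact n * (\<Prod>y\<in>Y. exp 1 * real (card (B y))) *
      exp (- (\<Sum>(x, y)\<in>E. rate (real (e x y)) (real (card (A x)) * real (card (B y)) / real n)))"
proof -
  let ?N = "{0..<n}"
  let ?G = "{\<sigma>. \<sigma> permutes ?N \<and> (\<forall>(x, y)\<in>E. card {j\<in>A x. \<sigma> j \<in> B y} = e x y)}"
  define \<mu> where "\<mu> = (\<lambda>(x, y). real (card (A x)) * real (card (B y)) / real n)"
  define \<tau> where "\<tau> = (\<lambda>p. real (e (fst p) (snd p)) / \<mu> p)"
  \<comment> \<open>\<open>None\<close> colours the points outside all \<open>B y\<close>;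
    disjointness makes the description under \<open>THE\<close> unique.\<close>
  define s where "s = (\<lambda>k. if \<exists>y\<in>Y. k \<in> B y then Some (THE y. y \<in> Y \<and> k \<in> B y) else None)"
  define Q where "Q = insert None (Some ` Y)"
  define t where "t = (\<lambda>j c. \<Prod>p\<in>E. if j \<in> A (fst p) \<and> c = Some (snd p) then \<tau> p else 1)"
  define b where "b = (\<lambda>c. card {k\<in>?N. s k = c})"
  have EXY: "fst p \<in> X" "snd p \<in> Y" if "p \<in> E" for p using that E by auto
  have finE: "finite E" using E X Y finite_subset by blast
  have finB: "finite (B y)" if "y \<in> Y" for y using Y(3)[OF that] finite_subset by blast
  have finA: "finite (A x)" if "x \<in> X" for x using X(3)[OF that] finite_subset by blast
  have finQ: "finite Q" using Y by (simp add: Q_def)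
  have s_Some: "s k = Some y \<longleftrightarrow> k \<in> B y" if "y \<in> Y" for k y
  proof -
    have uniq: "y' = y''" if "y' \<in> Y" "y'' \<in> Y" "k \<in> B y'" "k \<in> B y''" for y' y''
      using that Y(2) by (auto simp: disjoint_family_on_def)
    have "(THE y. y \<in> Y \<and> k \<in> B y) = y'" if "y' \<in> Y" "k \<in> B y'" for y'
      using that uniq by (intro the_equality) auto
    then show ?thesis using that unfolding s_def by auto
  qed
  have sQ: "s ` ?N \<subseteq> Q"
  proof safe
    fix k
    show "s k \<in> Q"
    proof (cases "\<exists>y\<in>Y. k \<in> B y")
      case True
      then obtain y where "y \<in> Y" "k \<in> B y" by auto
      then have "s k = Some y" using s_Some by simp
      then show ?thesis using \<open>y \<in> Y\<close> by (simp add: Q_def)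
    qed (simp add: s_def Q_def)
  qed
  have b_Some: "b (Some y) = card (B y)" if "y \<in> Y" for y
  proof -
    have "{k\<in>?N. s k = Some y} = B y" using Y(3)[OF that] s_Some[OF that] by auto
    then show ?thesis by (simp add: b_def)
  qed
  have b_pos: "card (B y) \<ge> 1" if "y \<in> Y" for y
    using Y(3)[OF that] finB[OF that] by (simp add: Suc_le_eq card_gt_0_iff)
  have a_pos: "card (A x) \<ge> 1" if "x \<in> X" for x
    using X(3)[OF that] finA[OF that] by (simp add: Suc_le_eq card_gt_0_iff)
  have \<mu>_pos: "\<mu> p > 0" if "p \<in> E" for p
    using that E b_pos[of "snd p"] a_pos[of "fst p"] n by (auto simp: \<mu>_def)
  have \<tau>_nonneg: "\<tau> p \<ge> 0" for p
    by (auto simp: \<tau>_def \<mu>_def case_prod_beta)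
  have t_nonneg: "t j c \<ge> 0" for j c
    unfolding t_def by (intro prod_nonneg) (auto simp: \<tau>_nonneg)
  have b_total: "(\<Sum>c\<in>Q. b c) = n"
    unfolding b_def using sum.group[of ?N Q s "\<lambda>_. 1::nat"] finQ sQ by simp
  then have b_total': "b None + (\<Sum>y\<in>Y. card (B y)) = n"
    unfolding Q_def using Y(1) b_Some by (simp add: sum.reindex)
  have t_eq: "t j c = 1 + (\<Sum>p\<in>E. if j \<in> A (fst p) \<and> c = Some (snd p) then \<tau> p - 1 else 0)" for j c
    unfolding t_def using finE
  proof (rule prod_single_factor)
    fix p q assume "p \<in> E" "q \<in> E" "j \<in> A (fst p) \<and> c = Some (snd p)" "j \<in> A (fst q) \<and> c = Some (snd q)"
    then show "p = q" 
      using E X(2) unfolding disjoint_family_on_def by (cases p, cases q) auto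
  qed
  \<comment> \<open>The mean of \<open>t j\<close> over the colours is \<open>1 + ?z\<close>,
    bounded by \<open>exp ?z\<close>, so that the product over \<open>j\<close> becomes the
    exponential of a sum.\<close>
  have column: "(\<Sum>c\<in>Q. real (b c) * t j c)
     \<le> real n * exp (\<Sum>p\<in>E. if j \<in> A (fst p) then real (card (B (snd p))) * (\<tau> p - 1) / real n else 0)"
    (is "_ \<le> _ * exp ?z") for j
  proof -
    have "(\<Sum>c\<in>Q. real (b c) * t j c) = real n +
       (\<Sum>c\<in>Q. \<Sum>p\<in>E. real (b c) * (if j \<in> A (fst p) \<and> c = Some (snd p) then \<tau> p - 1 else 0))"
      unfolding t_eq using b_total by (simp add: distrib_left sum.distrib sum_distrib_left flip: of_nat_sum)
    also have "(\<Sum>c\<in>Q. \<Sum>p\<in>E. real (b c) * (if j \<in> A (fst p) \<and> c = Some (snd p) then \<tau> p - 1 else 0))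
      = (\<Sum>p\<in>E. \<Sum>c\<in>Q. if c = Some (snd p) then (if j \<in> A (fst p) then real (b c) * (\<tau> p - 1) else 0) else 0)"
      by (subst sum.swap) (intro sum.cong, auto)
    also have "\<dots> = (\<Sum>p\<in>E. if j \<in> A (fst p) then real (card (B (snd p))) * (\<tau> p - 1) else 0)"
      using finQ E by (intro sum.cong) (auto simp: Q_def b_Some)
    also have "\<dots> = real n * ?z"
      using n by (subst sum_distrib_left) (intro sum.cong, auto)
    finally have "(\<Sum>c\<in>Q. real (b c) * t j c) = real n * (1 + ?z)" by (simp add: distrib_left)
    also have "\<dots> \<le> real n * exp ?z" by (intro mult_left_mono exp_ge_add_one_self) auto
    finally show ?thesis .
  qed
  \<comment> \<open>Summed over the points of \<open>A x\<close>, the exponents of a pair add up to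
    \<open>\<mu> * (\<tau> - 1)\<close>, which the choice of \<open>\<tau>\<close> turns into
    \<open>e - \<mu>\<close>.\<close>
  have columns: "(\<Prod>j<n. \<Sum>c\<in>Q. real (b c) * t j c) \<le> real n ^ n * exp (\<Sum>p\<in>E. real (e (fst p) (snd p)) - \<mu> p)"
  proof -
    have "(\<Prod>j<n. \<Sum>c\<in>Q. real (b c) * t j c) \<le>
       (\<Prod>j<n. real n * exp (\<Sum>p\<in>E. if j \<in> A (fst p) then real (card (B (snd p))) * (\<tau> p - 1) / real n else 0))"
      by (intro prod_mono) (auto intro!: sum_nonneg mult_nonneg_nonneg t_nonneg column)
    also have "\<dots> = real n ^ n * exp (\<Sum>j<n. \<Sum>p\<in>E. if j \<in> A (fst p) then real (card (B (snd p))) * (\<tau> p - 1) / real n else 0)"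
      by (simp add: prod.distrib exp_sum)
    also have "(\<Sum>j<n. \<Sum>p\<in>E. if j \<in> A (fst p) then real (card (B (snd p))) * (\<tau> p - 1) / real n else 0)
       = (\<Sum>p\<in>E. \<Sum>j<n. if j \<in> A (fst p) then real (card (B (snd p))) * (\<tau> p - 1) / real n else 0)"
      by (rule sum.swap)
    also have "\<dots> = (\<Sum>p\<in>E. real (e (fst p) (snd p)) - \<mu> p)"
    proof (intro sum.cong refl)
      fix p assume p: "p \<in> E"
      then have "A (fst p) \<subseteq> {..<n}" using EXY X(3) by (simp add: lessThan_atLeast0)
      then have "(\<Sum>j<n. if j \<in> A (fst p) then real (card (B (snd p))) * (\<tau> p - 1) / real n else 0)
        = real (card (A (fst p))) * (real (card (B (snd p))) * (\<tau> p - 1) / real n)"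
        by (simp flip: sum.inter_restrict add: Int_absorb1)
      also have "\<dots> = \<mu> p * (\<tau> p - 1)" by (simp add: \<mu>_def case_prod_beta)
      also have "\<dots> = real (e (fst p) (snd p)) - \<mu> p"
        using \<mu>_pos[OF p] by (simp add: \<tau>_def algebra_simps)
      finally show "(\<Sum>j<n. if j \<in> A (fst p) then real (card (B (snd p))) * (\<tau> p - 1) / real n else 0)
        = real (e (fst p) (snd p)) - \<mu> p" .
    qed
    finally show ?thesis .
  qed
  \<comment> \<open>On the event each pair contributes its tilt exactly \<open>e\<close> times, so
    the weight is constant there and Markov's inequality amounts to restricting a nonnegative sum to
    the event.\<close>
  have good: "(\<Prod>j<n. t j (s (\<sigma> j))) = (\<Prod>p\<in>E. \<tau> p ^ e (fst p) (snd p))" if "\<sigma> \<in> ?G" for \<sigma>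
  proof -
    have "(\<Prod>j<n. t j (s (\<sigma> j))) = (\<Prod>p\<in>E. \<Prod>j<n. if j \<in> A (fst p) \<and> s (\<sigma> j) = Some (snd p) then \<tau> p else 1)"
      unfolding t_def by (rule prod.swap)
    also have "\<dots> = (\<Prod>p\<in>E. \<tau> p ^ e (fst p) (snd p))"
    proof (intro prod.cong refl)
      fix p assume p: "p \<in> E"
      then have "snd p \<in> Y" "A (fst p) \<subseteq> {..<n}" using EXY X(3) by (auto simp: lessThan_atLeast0)
      then have *: "{j\<in>{..<n}. j \<in> A (fst p) \<and> s (\<sigma> j) = Some (snd p)} = {j\<in>A (fst p). \<sigma> j \<in> B (snd p)}"
        using s_Some by auto
      have "(\<Prod>j<n. if j \<in> A (fst p) \<and> s (\<sigma> j) = Some (snd p) then \<tau> p else 1)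
         = (\<Prod>j\<in>{j\<in>{..<n}. j \<in> A (fst p) \<and> s (\<sigma> j) = Some (snd p)}. \<tau> p)"
        by (rule prod.inter_filter[symmetric]) simp
      also have "\<dots> = \<tau> p ^ card {j\<in>A (fst p). \<sigma> j \<in> B (snd p)}" unfolding * by simp
      also have "card {j\<in>A (fst p). \<sigma> j \<in> B (snd p)} = e (fst p) (snd p)"
        using that p by auto
      finally show "(\<Prod>j<n. if j \<in> A (fst p) \<and> s (\<sigma> j) = Some (snd p) then \<tau> p else 1)
         = \<tau> p ^ e (fst p) (snd p)" .
    qed
    finally show ?thesis .
  qed
  have \<tau>_pow: "\<tau> p ^ e (fst p) (snd p) = exp (real (e (fst p) (snd p)) * ln (real (e (fst p) (snd p)) / \<mu> p))"
    if "p \<in> E" for p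
  proof (cases "e (fst p) (snd p) = 0")
    case False
    then have "\<tau> p > 0" using \<mu>_pos[OF that] by (simp add: \<tau>_def)
    then show ?thesis by (simp add: exp_of_nat_mult \<tau>_def)
  qed simp
  define T where "T = (\<Sum>p\<in>E. real (e (fst p) (snd p)) * ln (real (e (fst p) (snd p)) / \<mu> p))"
  have T: "(\<Prod>p\<in>E. \<tau> p ^ e (fst p) (snd p)) = exp T"
    unfolding T_def using finE \<tau>_pow by (simp add: exp_sum)
  have finP: "finite {\<sigma>. \<sigma> permutes ?N}" by (intro finite_permutations) auto
  have "real (card ?G) * exp T = (\<Sum>\<sigma>\<in>?G. \<Prod>j<n. t j (s (\<sigma> j)))"
    using good T by simp
  also have "\<dots> \<le> (\<Sum>\<sigma> | \<sigma> permutes ?N. \<Prod>j<n. t j (s (\<sigma> j)))"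
    by (intro sum_mono2 finP prod_nonneg t_nonneg) auto
  also have "\<dots> \<le> (\<Prod>c\<in>Q. fact (b c) / real (b c) ^ b c) * (\<Prod>j<n. \<Sum>c\<in>Q. real (b c) * t j c)"
    unfolding b_def by (rule sum_permutes_le[OF finQ sQ t_nonneg])
  also have "(\<Prod>c\<in>Q. fact (b c) / real (b c) ^ b c) =
     fact (b None) / real (b None) ^ b None * (\<Prod>y\<in>Y. fact (card (B y)) / real (card (B y)) ^ card (B y))"
    unfolding Q_def using Y(1) b_Some by (simp add: prod.reindex)
  also have "fact (b None) / real (b None) ^ b None * (\<Prod>y\<in>Y. fact (card (B y)) / real (card (B y)) ^ card (B y)) *
      (\<Prod>j<n. \<Sum>c\<in>Q. real (b c) * t j c)
     \<le> fact n / real n ^ n * (\<Prod>y\<in>Y. exp 1 * real (card (B y))) *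
      (real n ^ n * exp (\<Sum>p\<in>E. real (e (fst p) (snd p)) - \<mu> p))"
  proof (rule mult_mono[OF _ columns])
    show "fact (b None) / real (b None) ^ b None * (\<Prod>y\<in>Y. fact (card (B y)) / real (card (B y)) ^ card (B y))
       \<le> fact n / real n ^ n * (\<Prod>y\<in>Y. exp 1 * real (card (B y)))"
      using prod_fact_quot_le[of Y "\<lambda>y. card (B y)" "b None"] Y(1) b_pos b_total' by simp
  qed (auto intro!: prod_nonneg sum_nonneg mult_nonneg_nonneg divide_nonneg_nonneg t_nonneg)
  finally have main: "real (card ?G) * exp T \<le> fact n / real n ^ n * (\<Prod>y\<in>Y. exp 1 * real (card (B y))) *
      (real n ^ n * exp (\<Sum>p\<in>E. real (e (fst p) (snd p)) - \<mu> p))" .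
  have rates: "(\<Sum>(x, y)\<in>E. rate (real (e x y)) (real (card (A x)) * real (card (B y)) / real n))
     = T - (\<Sum>p\<in>E. real (e (fst p) (snd p)) - \<mu> p)"
    unfolding T_def sum_subtractf[symmetric]
    by (intro sum.cong) (auto simp: rate_def \<mu>_def)
  have "real (card ?G) = real (card ?G) * exp T * exp (- T)"
    by (simp add: exp_minus)
  also have "\<dots> \<le> fact n / real n ^ n * (\<Prod>y\<in>Y. exp 1 * real (card (B y))) *
      (real n ^ n * exp (\<Sum>p\<in>E. real (e (fst p) (snd p)) - \<mu> p)) * exp (- T)"
    using main by (intro mult_right_mono) auto
  also have "\<dots> = fact n * (\<Prod>y\<in>Y. exp 1 * real (card (B y))) *
     (exp (\<Sum>p\<in>E. real (e (fst p) (snd p)) - \<mu> p) * exp (- T))"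
    using n by simp
  also have "exp (\<Sum>p\<in>E. real (e (fst p) (snd p)) - \<mu> p) * exp (- T) =
     exp (- (\<Sum>(x, y)\<in>E. rate (real (e x y)) (real (card (A x)) * real (card (B y)) / real n)))"
    unfolding rates by (simp flip: exp_add)
  finally show ?thesis .
qed

section \<open>Loss of potency\<close>

lemma entropy_ge_quadratic:
  fixes x :: real
  assumes "x \<ge> 0"
  shows "(x - 1)\<^sup>2 \<le> 2 * (x * ln x - x + 1) * max x 1"
proof (cases "x \<le> 1")
  case True
  show ?thesis
  proof (cases "x = 0")
    case False
    \<comment> \<open>\<open>F 1 = 0\<close> and the derivative \<open>ln y - (y - 1)\<close> is
      nonpositive, so \<open>F\<close> is nonnegative to the left of \<open>1\<close>.\<close>
    define F where "F = (\<lambda>x::real. x * ln x - x + 1 - (x - 1)\<^sup>2 / 2)"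
    have "F x \<ge> F 1"
    proof (rule DERIV_nonpos_imp_nonincreasing[OF True])
      fix y assume y: "x \<le> y" "y \<le> 1"
      then have y0: "y > 0" using False assms by simp
      have "(F has_real_derivative (ln y - (y - 1))) (at y)"
        unfolding F_def using y0 by (auto intro!: derivative_eq_intros simp: field_simps)
      moreover have "ln y - (y - 1) \<le> 0" using ln_le_minus_one[OF y0] by simp
      ultimately show "\<exists>z. (F has_real_derivative z) (at y) \<and> z \<le> 0" by blast
    qed
    then show ?thesis using True by (simp add: F_def max_def)
  qed simp
next
  case False
  then have x: "x > 1" by simp
  \<comment> \<open>This is the right side minus the left side, divided by
    \<open>2 * x\<^sup>2\<close>; the division turns the derivative into
    \<open>(1 - 1 / y)\<^sup>2 / y\<close>.\<close>
  define G where "G = (\<lambda>x::real. ln x - 1 + 1 / x - (1 - 1 / x)\<^sup>2 / 2)"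
  have "G 1 \<le> G x"
  proof (rule DERIV_nonneg_imp_nondecreasing[of 1 x G])
    fix y assume y: "1 \<le> y" "y \<le> x"
    have "(G has_real_derivative ((1 / y - 1 / y\<^sup>2) - (1 - 1 / y) * (1 / y\<^sup>2))) (at y)"
      unfolding G_def using y by (auto intro!: derivative_eq_intros simp: power2_eq_square field_simps)
    moreover have "(1 / y - 1 / y\<^sup>2) - (1 - 1 / y) * (1 / y\<^sup>2) = (1 - 1 / y) * (1 - 1 / y) / y"
      using y by (simp add: power2_eq_square field_simps)
    moreover have "\<dots> \<ge> 0" using y by simp
    ultimately show "\<exists>z. (G has_real_derivative z) (at y) \<and> 0 \<le> z" by metis
  qed (use x in simp)
  then have "0 \<le> G x * (2 * x\<^sup>2)" by (simp add: G_def)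
  also have "\<dots> = 2 * (x * ln x - x + 1) * x - (x - 1)\<^sup>2"
    using x by (simp add: G_def power2_eq_square field_simps)
  finally show ?thesis using x by (simp add: max_def)
qed

lemma rate_eq: "\<mu> > 0 \<Longrightarrow> rate e \<mu> = \<mu> * (e / \<mu> * ln (e / \<mu>) - e / \<mu> + 1)"
  by (simp add: rate_def field_simps)

lemma rate_quadratic:
  assumes "e \<ge> 0" "\<mu> > 0"
  shows "(e - \<mu>)\<^sup>2 \<le> 2 * rate e \<mu> * max e \<mu>"
proof -
  have "(e - \<mu>)\<^sup>2 = \<mu>\<^sup>2 * (e / \<mu> - 1)\<^sup>2"
    using assms by (simp add: power2_eq_square field_simps)
  also have "\<dots> \<le> \<mu>\<^sup>2 * (2 * (e / \<mu> * ln (e / \<mu>) - e / \<mu> + 1) * max (e / \<mu>) 1)"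
    using assms by (intro mult_left_mono entropy_ge_quadratic) auto
  also have "\<dots> = 2 * rate e \<mu> * (\<mu> * max (e / \<mu>) 1)"
    using assms by (simp add: rate_eq power2_eq_square)
  also have "\<mu> * max (e / \<mu>) 1 = max e \<mu>"
    using assms by (simp add: max_def field_simps)
  finally show ?thesis .
qed

text \<open>The quadratic bound forces the sign, because \<open>max e \<mu>\<close> is
  positive.\<close>

lemma rate_nonneg: "e \<ge> 0 \<Longrightarrow> \<mu> > 0 \<Longrightarrow> rate e \<mu> \<ge> 0"
  using rate_quadratic[of e \<mu>]
  by (smt (verit) mult_neg_pos mult_pos_pos max_def zero_le_power2)

text \<open>The logarithm is at least \<open>1 + q\<close>, and the \<open>1\<close> pays for the
  term \<open>- e\<close>. This serves edges whose count far exceeds its mean.\<close>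

lemma rate_linear:
  assumes "\<mu> > 0" "exp (1 + q) * \<mu> \<le> e"
  shows "q * e \<le> rate e \<mu>"
proof -
  have e: "e > 0" using assms by (smt (verit) exp_gt_zero mult_pos_pos)
  have "1 + q \<le> ln (e / \<mu>)"
    using assms e by (subst ln_ge_iff) (auto simp: field_simps)
  then have "e * (1 + q) \<le> e * ln (e / \<mu>)" using e by (intro mult_left_mono) auto
  then show ?thesis using assms unfolding rate_def by (simp add: algebra_simps)
qed

section \<open>Dyadic sums within one fibre\<close>

lemma sum_dyadic_le:
  fixes c :: real
  assumes K: "finite K" and c: "c > 0"
  shows "(\<Sum>k\<in>K. min (c * 2 ^ k) (1 / sqrt (c * 2 ^ k))) \<le> 6"
proof -
  \<comment> \<open>The sum is cut where \<open>c * 2 ^ k\<close> passes \<open>1\<close>: up to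
    there it is at most twice its last term, hence at most \<open>2\<close>, and beyond it decays by
    \<open>1 / sqrt 2\<close> per step.\<close>
  define K1 where "K1 = {k\<in>K. c * 2 ^ k \<le> 1}"
  define K2 where "K2 = K - K1"
  have fin: "finite K1" "finite K2" and KU: "K = K1 \<union> K2" "K1 \<inter> K2 = {}"
    using K by (auto simp: K1_def K2_def)
  have s1: "(\<Sum>k\<in>K1. c * 2 ^ k) \<le> 2"
  proof (cases "K1 = {}")
    case False
    define m where "m = Max K1"
    have m: "m \<in> K1" "K1 \<subseteq> {..<Suc m}"
      using fin False by (auto simp: m_def less_Suc_eq_le)
    have "(\<Sum>k\<in>K1. c * 2 ^ k) \<le> (\<Sum>k<Suc m. c * 2 ^ k)"
      using m c by (intro sum_mono2) auto
    also have "\<dots> = c * (2 ^ Suc m - 1)"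
      using geometric_sum[of "2::real" "Suc m"] by (simp flip: sum_distrib_left del: sum.lessThan_Suc)
    also have "\<dots> \<le> 2 * (c * 2 ^ m)" using c by (simp add: algebra_simps)
    also have "\<dots> \<le> 2" using m(1) by (simp add: K1_def)
    finally show ?thesis .
  qed simp
  have s2: "(\<Sum>k\<in>K2. 1 / sqrt (c * 2 ^ k)) \<le> 4"
  proof (cases "K2 = {}")
    case False
    define m where "m = Min K2"
    have m: "m \<in> K2" "\<And>k. k \<in> K2 \<Longrightarrow> m \<le> k"
      using fin False by (auto simp: m_def)
    have cm: "c * 2 ^ m > 1" using m(1) by (auto simp: K2_def K1_def)
    \<comment> \<open>The rational ratio \<open>3 / 4\<close> gives the geometric series the exact
      sum \<open>4\<close>.\<close>
    have r: "1 / sqrt 2 \<le> (3 / 4 :: real)"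
      using real_le_rsqrt[of "4/3" 2] by (simp add: field_simps power2_eq_square)
    have bnd: "1 / sqrt (c * 2 ^ k) \<le> (3 / 4) ^ (k - m)" if "k \<in> K2" for k
    proof -
      have "(2::real) ^ k = 2 ^ m * 2 ^ (k - m)" using m(2)[OF that] by (simp flip: power_add)
      then have "c * 2 ^ k \<ge> 2 ^ (k - m)"
        using mult_right_mono[of 1 "c * 2 ^ m" "2 ^ (k - m)"] cm by (simp add: mult_ac)
      then have "1 / sqrt (c * 2 ^ k) \<le> 1 / sqrt (2 ^ (k - m))"
        by (intro divide_left_mono real_sqrt_le_mono) (use c in auto)
      also have "\<dots> = (1 / sqrt 2) ^ (k - m)" by (simp add: real_sqrt_power power_divide)
      also have "\<dots> \<le> (3 / 4) ^ (k - m)" using r by (intro power_mono) auto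
      finally show ?thesis .
    qed
    have "(\<Sum>k\<in>K2. 1 / sqrt (c * 2 ^ k)) \<le> (\<Sum>k\<in>K2. (3 / 4) ^ (k - m))"
      by (intro sum_mono bnd)
    also have "\<dots> = (\<Sum>j\<in>(\<lambda>k. k - m) ` K2. (3 / 4) ^ j)"
      using m(2) by (subst sum.reindex) (auto simp: inj_on_def intro: eq_diff_iff[THEN iffD1])
    also have "\<dots> \<le> (\<Sum>j. (3 / 4 :: real) ^ j)"
      using fin by (intro sum_le_suminf) auto
    also have "\<dots> = 4" by (subst suminf_geometric) auto
    finally show ?thesis .
  qed simp
  have "(\<Sum>k\<in>K. min (c * 2 ^ k) (1 / sqrt (c * 2 ^ k))) =
     (\<Sum>k\<in>K1. min (c * 2 ^ k) (1 / sqrt (c * 2 ^ k))) + (\<Sum>k\<in>K2. min (c * 2 ^ k) (1 / sqrt (c * 2 ^ k)))"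
    unfolding KU(1) using fin KU(2) by (rule sum.union_disjoint)
  also have "\<dots> \<le> (\<Sum>k\<in>K1. c * 2 ^ k) + (\<Sum>k\<in>K2. 1 / sqrt (c * 2 ^ k))"
    by (intro add_mono sum_mono) auto
  finally show ?thesis using s1 s2 by linarith
qed

lemma sum_mult_le_sqrt:
  fixes f g :: "'a \<Rightarrow> real"
  shows "(\<Sum>i\<in>A. f i * g i) \<le> sqrt (\<Sum>i\<in>A. (f i)\<^sup>2) * sqrt (\<Sum>i\<in>A. (g i)\<^sup>2)"
  using Cauchy_Schwarz_ineq_sum[of f g A] by (metis real_le_rsqrt real_sqrt_mult)

text \<open>The mass bound gives \<open>w * sqrt a \<le> sqrt s\<close> in each class. For small
  \<open>w\<close> the bound \<open>a \<le> n\<close> is stronger; for large \<open>w\<close> a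
  class of mass at most \<open>s\<close> is so sparse that the fourth root decays. Both ends are
  geometric, so the number of classes does not enter.\<close>

lemma sum_dyadic_weights_le:
  fixes a :: "nat \<Rightarrow> real"
  assumes K: "finite K" and w0: "w0 > 0" and n: "n > 0"
    and a: "\<And>k. k \<in> K \<Longrightarrow> 0 < a k \<and> a k \<le> n"
    and s: "(\<Sum>k\<in>K. (w0 * 2 ^ k)\<^sup>2 * a k) \<le> s"
  shows "(\<Sum>k\<in>K. (w0 * 2 ^ k) * sqrt (a k) * sqrt (sqrt (a k / n))) \<le> 6 * sqrt s"
proof (cases "K = {}")
  case True
  then show ?thesis using s by simp
next
  case False
  have le: "(w0 * 2 ^ k)\<^sup>2 * a k \<le> s" if "k \<in> K" for k
    using member_le_sum[of k K "\<lambda>k. (w0 * 2 ^ k)\<^sup>2 * a k"] K a s that by force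
  obtain k where "k \<in> K" using False by blast
  then have s0: "s > 0" using le[of k] a[of k] w0
    by (meson less_le_trans mult_pos_pos zero_less_numeral zero_less_power)
  \<comment> \<open>\<open>c * 2 ^ k\<close> is the square root of the ratio of
    \<open>w\<^sup>2 * n\<close>, the mass of a full fibre at level \<open>k\<close>, to
    \<open>s\<close>; its value \<open>1\<close> separates the two regimes.\<close>
  define c where "c = w0 * sqrt n / sqrt s"
  have c: "c > 0" using w0 n s0 by (simp add: c_def)
  have "(w0 * 2 ^ k) * sqrt (a k) * sqrt (sqrt (a k / n)) \<le> sqrt s * min (c * 2 ^ k) (1 / sqrt (c * 2 ^ k))"
    if k: "k \<in> K" for k
  proof -
    define w where "w = w0 * 2 ^ k"
    have w: "w > 0" using w0 by (simp add: w_def)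
    have ck: "c * 2 ^ k = w * sqrt n / sqrt s" by (simp add: c_def w_def)
    have root: "w * sqrt (a k) \<le> sqrt s"
      using real_sqrt_le_mono[OF le[OF k]] w by (simp add: real_sqrt_mult w_def)
    have u: "sqrt (a k / n) \<le> 1" using a[OF k] n by simp
    have "w * sqrt (a k) * sqrt (sqrt (a k / n)) \<le> w * sqrt n * 1"
      using a[OF k] n w u by (intro mult_mono) auto
    also have "\<dots> = sqrt s * (c * 2 ^ k)" using s0 by (simp add: ck)
    finally have 1: "w * sqrt (a k) * sqrt (sqrt (a k / n)) \<le> sqrt s * (c * 2 ^ k)" .
    have "sqrt (a k / n) \<le> 1 / (c * 2 ^ k)"
      using root w n s0 by (simp add: ck real_sqrt_divide field_simps)
    then have "sqrt (sqrt (a k / n)) \<le> sqrt (1 / (c * 2 ^ k))" by (rule real_sqrt_le_mono)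
    then have "w * sqrt (a k) * sqrt (sqrt (a k / n)) \<le> sqrt s * (1 / sqrt (c * 2 ^ k))"
      using a[OF k] n w root s0 by (intro mult_mono) (auto simp: real_sqrt_divide)
    with 1 show ?thesis by (simp add: w_def min_def)
  qed
  then have "(\<Sum>k\<in>K. (w0 * 2 ^ k) * sqrt (a k) * sqrt (sqrt (a k / n)))
     \<le> (\<Sum>k\<in>K. sqrt s * min (c * 2 ^ k) (1 / sqrt (c * 2 ^ k)))"
    by (rule sum_mono)
  also have "\<dots> \<le> sqrt s * 6"
    unfolding sum_distrib_left[symmetric] using s0 by (intro mult_left_mono sum_dyadic_le K c) auto
  finally show ?thesis by simp
qed

text \<open>The edges are split at \<open>e = \<Lambda> * \<mu>\<close>. Heavy ones are charged
  linearly to the rate, using \<open>v y \<le> D * w\<close>; light ones are charged through the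
  quadratic bound and Cauchy-Schwarz, which produces the second summand.\<close>

lemma vertex_loss_le:
  fixes v b e :: "'y \<Rightarrow> real"
  assumes Y: "finite Y" and n: "n > 0" and a: "0 < a" "a \<le> n" and w: "w > 0" and D: "D \<ge> 0"
    and \<kappa>: "\<kappa> \<ge> 0"
    and y: "\<And>y. y \<in> Y \<Longrightarrow> v y > 0 \<and> v y \<le> D * w \<and> b y > 0 \<and> e y \<ge> 0"
    and T: "(\<Sum>y\<in>Y. (v y)\<^sup>2 * b y) \<le> T"
    and small: "(\<Sum>y\<in>Y. rate (e y) (a * b y / n)) \<le> \<kappa> * a * (1 + ln (n / a))"
  shows "(\<Sum>y\<in>Y. w * v y * \<bar>e y - a * b y / n\<bar>) \<le>
    4 * \<kappa> * D * w\<^sup>2 * a + sqrt (32 * \<kappa> * T) * (w * sqrt a * sqrt (sqrt (a / n)))"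
proof -
  define l where "l = 1 + ln (n / a)"
  \<comment> \<open>The exponent \<open>l / 4\<close> makes \<open>\<Lambda>\<close> a constant
    times \<open>1 / r\<close>, so that \<open>\<Lambda> * l * (a / n)\<close> still retains a
    factor \<open>r\<^sup>2 = sqrt (a / n)\<close>.\<close>
  define \<Lambda> where "\<Lambda> = exp (1 + l / 4)"
  define r where "r = sqrt (sqrt (a / n))"
  let ?\<mu> = "\<lambda>y. a * b y / n"
  let ?I = "\<lambda>y. rate (e y) (?\<mu> y)"
  have l: "l \<ge> 1" using a n by (simp add: l_def)
  have \<Lambda>: "\<Lambda> \<ge> 1" using l by (simp add: \<Lambda>_def)
  have r: "r > 0" using a n by (simp add: r_def)
  have r2: "r\<^sup>2 = sqrt (a / n)" using a n by (simp add: r_def)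
  have r4: "r ^ 4 = a / n"
    using r2 a n by (metis (no_types, opaque_lifting) divide_nonneg_pos less_imp_le num_double
        numeral_times_numeral power_mult real_sqrt_pow2)
  have lnr: "ln (n / a) = 4 * ln (1 / r)"
  proof -
    have "n / a = (1 / r) ^ 4" using r4 by (simp add: power_divide)
    then show ?thesis using r by (simp add: ln_realpow)
  qed
  \<comment> \<open>The factors are \<open>exp 1 \<le> 3\<close> and
    \<open>exp (1/4) \<le> 4/3\<close>, the latter from \<open>exp (-1/4) \<ge> 3/4\<close>.\<close>
  have exp54: "exp (5 / 4) \<le> (4::real)"
  proof -
    have "exp (-(1/4)) \<ge> (3/4 :: real)" using exp_ge_add_one_self[of "-(1/4) :: real"] by simp
    then have "exp (1/4) \<le> (4/3 :: real)" by (simp add: exp_minus field_simps)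
    moreover have "exp (5/4) = exp 1 * exp (1/4 :: real)" by (simp flip: exp_add)
    ultimately show ?thesis
      using exp_le mult_mono[of "exp 1" 3 "exp (1/4)" "4/3 :: real"] by simp
  qed
  have \<Lambda>r: "\<Lambda> \<le> 4 / r"
  proof -
    have "1 + l / 4 = 5 / 4 + ln (1 / r)" unfolding l_def lnr by (simp add: field_simps)
    then have "\<Lambda> = exp (5 / 4) * (1 / r)" using r by (simp add: \<Lambda>_def exp_add)
    then show ?thesis using exp54 r by (simp add: field_simps)
  qed
  have lr: "l \<le> 4 / r"
    using ln_le_minus_one[of "1 / r"] r by (simp add: l_def lnr)
  have \<Lambda>lu: "\<Lambda> * l * (a / n) \<le> 16 * r\<^sup>2"
  proof -
    have "\<Lambda> * l * (a / n) \<le> (4 / r) * (4 / r) * r ^ 4"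
      unfolding r4 using \<Lambda>r lr l r \<Lambda> a n by (intro mult_mono) auto
    also have "\<dots> = 16 * r\<^sup>2" using r by (simp add: field_simps power2_eq_square power4_eq_xxxx)
    finally show ?thesis .
  qed
  have \<mu>: "?\<mu> y > 0" if "y \<in> Y" for y using y[OF that] a n by simp
  have I0: "?I y \<ge> 0" if "y \<in> Y" for y using rate_nonneg \<mu>[OF that] y[OF that] by blast
  have vb0: "(\<Sum>y\<in>Y. (v y)\<^sup>2 * b y) \<ge> 0"
    using y by (intro sum_nonneg mult_nonneg_nonneg) (auto intro: less_imp_le)
  then have T0: "T \<ge> 0" using T by linarith
  \<comment> \<open>Each edge satisfies one of the two bounds; as both are nonnegative, their sum
    covers every edge.\<close>
  have bnd: "w * v y * \<bar>e y - ?\<mu> y\<bar> \<le> w\<^sup>2 * D * (4 / l) * ?I y + w * (sqrt (?I y) * (v y * sqrt (2 * \<Lambda> * ?\<mu> y)))"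
    if yY: "y \<in> Y" for y
  proof (cases "e y \<ge> \<Lambda> * ?\<mu> y")
    case True
    then have "l / 4 * e y \<le> ?I y"
      unfolding \<Lambda>_def by (intro rate_linear \<mu> yY)
    then have e: "e y \<le> 4 / l * ?I y" using l by (simp add: field_simps)
    have "?\<mu> y \<le> \<Lambda> * ?\<mu> y" using mult_right_mono[OF \<Lambda>, of "?\<mu> y"] \<mu>[OF yY] by simp
    then have "\<bar>e y - ?\<mu> y\<bar> \<le> e y" using True \<mu>[OF yY] by linarith
    then have "w * v y * \<bar>e y - ?\<mu> y\<bar> \<le> w * (D * w) * (4 / l * ?I y)"
      using e y[OF yY] w D by (intro mult_mono) auto
    moreover have "w * (sqrt (?I y) * (v y * sqrt (2 * \<Lambda> * ?\<mu> y))) \<ge> 0"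
      using w y[OF yY] a n \<Lambda> I0[OF yY] by (intro mult_nonneg_nonneg) auto
    ultimately show ?thesis by (simp add: power2_eq_square mult_ac)
  next
    case False
    have "?\<mu> y \<le> \<Lambda> * ?\<mu> y" using mult_right_mono[OF \<Lambda>, of "?\<mu> y"] \<mu>[OF yY] by simp
    then have "max (e y) (?\<mu> y) \<le> \<Lambda> * ?\<mu> y" using False by simp
    then have "2 * ?I y * max (e y) (?\<mu> y) \<le> 2 * ?I y * (\<Lambda> * ?\<mu> y)"
      using I0[OF yY] by (intro mult_left_mono) auto
    then have "(e y - ?\<mu> y)\<^sup>2 \<le> ?I y * (2 * \<Lambda> * ?\<mu> y)"
      using rate_quadratic[of "e y" "?\<mu> y"] y[OF yY] \<mu>[OF yY] by (simp add: mult_ac)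
    then have "sqrt ((e y - ?\<mu> y)\<^sup>2) \<le> sqrt (?I y * (2 * \<Lambda> * ?\<mu> y))" by (rule real_sqrt_le_mono)
    then have "\<bar>e y - ?\<mu> y\<bar> \<le> sqrt (?I y) * sqrt (2 * \<Lambda> * ?\<mu> y)"
      by (simp only: real_sqrt_abs real_sqrt_mult)
    then have "w * v y * \<bar>e y - ?\<mu> y\<bar> \<le> w * v y * (sqrt (?I y) * sqrt (2 * \<Lambda> * ?\<mu> y))"
      using w y[OF yY] by (intro mult_left_mono) auto
    moreover have "w\<^sup>2 * D * (4 / l) * ?I y \<ge> 0" using D l I0[OF yY] by simp
    ultimately show ?thesis by (simp only: mult_ac)
  qed
  have lin: "(\<Sum>y\<in>Y. w\<^sup>2 * D * (4 / l) * ?I y) \<le> 4 * \<kappa> * D * w\<^sup>2 * a"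
  proof -
    have "(\<Sum>y\<in>Y. w\<^sup>2 * D * (4 / l) * ?I y) = w\<^sup>2 * D * (4 / l) * (\<Sum>y\<in>Y. ?I y)"
      by (simp add: sum_distrib_left)
    also have "\<dots> \<le> w\<^sup>2 * D * (4 / l) * (\<kappa> * a * l)"
      using small D l by (intro mult_left_mono) (auto simp: l_def)
    also have "\<dots> = 4 * \<kappa> * D * w\<^sup>2 * a" using l by simp
    finally show ?thesis .
  qed
  have "(\<Sum>y\<in>Y. sqrt (?I y) * (v y * sqrt (2 * \<Lambda> * ?\<mu> y)))
     \<le> sqrt (\<Sum>y\<in>Y. (sqrt (?I y))\<^sup>2) * sqrt (\<Sum>y\<in>Y. (v y * sqrt (2 * \<Lambda> * ?\<mu> y))\<^sup>2)"
    by (rule sum_mult_le_sqrt)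
  also have "(\<Sum>y\<in>Y. (sqrt (?I y))\<^sup>2) = (\<Sum>y\<in>Y. ?I y)"
    using I0 by (intro sum.cong) auto
  also have "(\<Sum>y\<in>Y. (v y * sqrt (2 * \<Lambda> * ?\<mu> y))\<^sup>2) = 2 * \<Lambda> * (a / n) * (\<Sum>y\<in>Y. (v y)\<^sup>2 * b y)"
    unfolding sum_distrib_left
  proof (intro sum.cong refl)
    fix z assume "z \<in> Y"
    then have "2 * \<Lambda> * ?\<mu> z \<ge> 0" using \<mu>[of z] \<Lambda> by (intro mult_nonneg_nonneg) auto
    then show "(v z * sqrt (2 * \<Lambda> * ?\<mu> z))\<^sup>2 = 2 * \<Lambda> * (a / n) * ((v z)\<^sup>2 * b z)"
      by (simp add: power_mult_distrib)
  qed
  also have "sqrt (\<Sum>y\<in>Y. ?I y) * sqrt (2 * \<Lambda> * (a / n) * (\<Sum>y\<in>Y. (v y)\<^sup>2 * b y))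
    \<le> sqrt (\<kappa> * a * l) * sqrt (2 * \<Lambda> * (a / n) * T)"
    using small T \<Lambda> a n \<kappa> l vb0
    by (intro mult_mono real_sqrt_le_mono mult_left_mono)
      (auto simp: l_def intro!: mult_nonneg_nonneg divide_nonneg_nonneg)
  also have "\<dots> = sqrt (2 * \<kappa> * T * a * (\<Lambda> * l * (a / n)))"
    by (simp add: mult_ac flip: real_sqrt_mult)
  also have "\<dots> \<le> sqrt (2 * \<kappa> * T * a * (16 * r\<^sup>2))"
    using \<Lambda>lu \<kappa> T0 a by (intro real_sqrt_le_mono mult_left_mono) auto
  also have "\<dots> = sqrt (32 * \<kappa> * T) * (sqrt a * r)"
    using r by (simp add: real_sqrt_mult flip: r_def)
  finally have "w * (\<Sum>y\<in>Y. sqrt (?I y) * (v y * sqrt (2 * \<Lambda> * ?\<mu> y))) \<le> w * (sqrt (32 * \<kappa> * T) * (sqrt a * r))"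
    using w by (intro mult_left_mono) auto
  moreover have "(\<Sum>y\<in>Y. w * v y * \<bar>e y - ?\<mu> y\<bar>) \<le>
     (\<Sum>y\<in>Y. w\<^sup>2 * D * (4 / l) * ?I y) + w * (\<Sum>y\<in>Y. sqrt (?I y) * (v y * sqrt (2 * \<Lambda> * ?\<mu> y)))"
    unfolding sum_distrib_left[of w] sum.distrib[symmetric] by (intro sum_mono bnd)
  ultimately show ?thesis using lin by (simp add: r_def mult_ac)
qed

text \<open>Deleting a bad vertex \<open>x\<close> removes the ordered pairs \<open>(x, y)\<close>
  and \<open>(y, x)\<close>, whence the factor \<open>2\<close>. The loss bound is assumed for every
  \<open>S \<subseteq> S0\<close> because badness is judged in the set that remains at that
  moment.\<close>

lemma greedy_removal:
  fixes v :: "'a \<Rightarrow> 'a \<Rightarrow> real" and adj :: "'a \<Rightarrow> 'a \<Rightarrow> bool"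
  assumes sym: "\<And>x y. adj x y \<Longrightarrow> adj y x \<and> v y x = v x y" and irrefl: "\<And>x. \<not> adj x x"
    and "finite S0"
    and "\<And>S x. S \<subseteq> S0 \<Longrightarrow> x \<in> S \<Longrightarrow> \<not> good S x \<Longrightarrow> (\<Sum>y\<in>{y\<in>S. adj x y}. \<bar>v x y\<bar>) \<le> loss x"
  shows "\<exists>S\<subseteq>S0. (\<forall>x\<in>S. good S x) \<and>
    \<bar>\<Sum>(x, y)\<in>{(x, y). x \<in> S0 \<and> y \<in> S0 \<and> adj x y}. v x y\<bar> \<le>
    \<bar>\<Sum>(x, y)\<in>{(x, y). x \<in> S \<and> y \<in> S \<and> adj x y}. v x y\<bar> + 2 * (\<Sum>x\<in>S0 - S. loss x)"
  using assms(3,4)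
proof (induction S0 rule: finite_psubset_induct)
  case (psubset S0)
  define W where "W = (\<lambda>S. \<Sum>(x, y)\<in>{(x, y). x \<in> S \<and> y \<in> S \<and> adj x y}. v x y)"
  show ?case
  proof (cases "\<forall>x\<in>S0. good S0 x")
    case True
    then show ?thesis by (intro exI[of _ S0]) simp
  next
    case False
    then obtain x where x: "x \<in> S0" "\<not> good S0 x" by auto
    define R where "R = S0 - {x}"
    define N where "N = {y\<in>S0. adj x y}"
    have N: "finite N" "x \<notin> N" "N \<subseteq> R" using psubset.hyps irrefl by (auto simp: N_def R_def)
    have R: "R \<subset> S0" "finite R" using x psubset.hyps by (auto simp: R_def)
    let ?P = "\<lambda>S. {(x, y). x \<in> S \<and> y \<in> S \<and> adj x y}"
    have fin: "finite (?P R)" by (rule finite_subset[of _ "R \<times> R"]) (use R in auto)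
    have split: "?P S0 = ?P R \<union> (Pair x ` N \<union> (\<lambda>y. (y, x)) ` N)"
      using x sym irrefl by (auto simp: R_def N_def)
    have "W S0 = W R + ((\<Sum>(x, y)\<in>Pair x ` N. v x y) + (\<Sum>(x, y)\<in>(\<lambda>y. (y, x)) ` N. v x y))"
      unfolding W_def split using fin N
      by (subst sum.union_disjoint sum.union_disjoint; auto simp: R_def)+
    also have "(\<Sum>(x, y)\<in>Pair x ` N. v x y) = (\<Sum>y\<in>N. v x y)"
      by (subst sum.reindex) (auto simp: inj_on_def)
    also have "(\<Sum>(x, y)\<in>(\<lambda>y. (y, x)) ` N. v x y) = (\<Sum>y\<in>N. v y x)"
      by (subst sum.reindex) (auto simp: inj_on_def)
    also have "\<dots> = (\<Sum>y\<in>N. v x y)"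
      using sym by (intro sum.cong) (auto simp: N_def)
    finally have "W S0 = W R + 2 * (\<Sum>y\<in>N. v x y)" by simp
    moreover have "\<bar>\<Sum>y\<in>N. v x y\<bar> \<le> loss x"
      unfolding N_def using psubset.prems[of S0 x] x by (intro order_trans[OF sum_abs]) auto
    ultimately have WR: "\<bar>W S0\<bar> \<le> \<bar>W R\<bar> + 2 * loss x" by linarith
    have "\<exists>S\<subseteq>R. (\<forall>x\<in>S. good S x) \<and> \<bar>W R\<bar> \<le> \<bar>W S\<bar> + 2 * (\<Sum>x\<in>R - S. loss x)"
      unfolding W_def using R psubset.prems by (intro psubset.IH) auto
    then obtain S where S: "S \<subseteq> R" "\<forall>x\<in>S. good S x" "\<bar>W R\<bar> \<le> \<bar>W S\<bar> + 2 * (\<Sum>x\<in>R - S. loss x)"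
      by blast
    have "S0 - S = insert x (R - S)" "x \<notin> R - S" using x S(1) by (auto simp: R_def)
    then have "(\<Sum>x\<in>S0 - S. loss x) = loss x + (\<Sum>x\<in>R - S. loss x)"
      using R by simp
    then have "\<bar>W S0\<bar> \<le> \<bar>W S\<bar> + 2 * (\<Sum>x\<in>S0 - S. loss x)" using WR S(3) by simp
    then show ?thesis using S R unfolding W_def by (intro exI[of _ S]) auto
  qed
qed

section \<open>Supports of patterns and sums over neighbours\<close>

lemma wt_pos: "n \<ge> 1 \<Longrightarrow> h \<ge> 1 \<Longrightarrow> wt n h k > 0"
  by (simp add: wt_def)

text \<open>The weight ratio \<open>2 ^ (k - k0)\<close> is at most \<open>d\<close>, and
  \<open>m < 2 ^ m\<close> then confines \<open>k\<close> to a window of length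
  \<open>d\<close>.\<close>

lemma pattern_supp_subset:
  assumes "n \<ge> 1" "is_pattern d n h adjH a e"
  obtains k0 where "supp a \<subseteq> {0..<h} \<times> {k0..<k0 + d}"
proof -
  obtain k0 where k0: "\<And>i k. a (i, k) \<noteq> 0 \<Longrightarrow> wt n h k0 \<le> wt n h k \<and> wt n h k \<le> real d * wt n h k0"
    using assms(2) unfolding is_pattern_def by blast
  have "i < h \<and> k0 \<le> k \<and> k < k0 + d" if "(i, k) \<in> supp a" for i k
  proof -
    have nz: "a (i, k) \<noteq> 0" using that by (simp add: supp_def)
    then have i: "i < h" using assms(2) unfolding is_pattern_def by (meson not_le)
    define q where "q = sqrt (real n * real h)"
    have q: "q > 0" using assms(1) i by (simp add: q_def)
    have "wt n h j = 2 ^ j / q" for j by (simp add: wt_def q_def)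
    then have "2 ^ k0 / q \<le> 2 ^ k / q" "2 ^ k / q \<le> real d * (2 ^ k0 / q)"
      using k0[OF nz] by simp_all
    then have le: "(2::real) ^ k0 \<le> 2 ^ k" "(2::real) ^ k \<le> real d * 2 ^ k0"
      using q by (simp_all add: field_simps)
    then have k: "k0 \<le> k" by simp
    have "(2::real) ^ k = 2 ^ k0 * 2 ^ (k - k0)" using k by (simp flip: power_add)
    then have "(2::real) ^ (k - k0) \<le> real d" using le(2) by simp
    then have "2 ^ (k - k0) \<le> d" by (metis numeral_power_le_of_nat_cancel_iff)
    then have "k - k0 < d" using less_exp[of "k - k0"] by linarith
    then show ?thesis using i k by simp
  qed
  then show ?thesis by (intro that[of k0]) auto
qed

lemma pattern_finite_supp: "n \<ge> 1 \<Longrightarrow> is_pattern d n h adjH a e \<Longrightarrow> finite (supp a)"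
  by (metis pattern_supp_subset finite_subset finite_SigmaI finite_atLeastLessThan)

text \<open>The bound is independent of \<open>n\<close> and of the pattern, which lets a constant
  factor per vertex be collected into one constant.\<close>

lemma pattern_card_supp_le:
  assumes "n \<ge> 1" "is_pattern d n h adjH a e"
  shows "card (supp a) \<le> h * d"
proof -
  obtain k0 where "supp a \<subseteq> {0..<h} \<times> {k0..<k0 + d}" using pattern_supp_subset assms by blast
  then have "card (supp a) \<le> card ({0..<h} \<times> {k0..<k0 + d})" by (intro card_mono) auto
  then show ?thesis by (simp add: card_cartesian_product)
qed

lemma pattern_fst_less: "n \<ge> 1 \<Longrightarrow> is_pattern d n h adjH a e \<Longrightarrow> x \<in> supp a \<Longrightarrow> fst x < h"
  using pattern_supp_subset[of n d h adjH a e] by (metis atLeastLessThan_iff mem_Times_iff subsetD)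

lemma pattern_le:
  assumes "n \<ge> 1" "is_pattern d n h adjH a e" "x \<in> supp a"
  shows "a x \<le> n"
proof -
  obtain i k where x: "x = (i, k)" by fastforce
  have i: "i < h" using pattern_fst_less[OF assms] x by simp
  have fin: "finite {k. (i, k) \<in> supp a}"
    using finite_vimageI[OF pattern_finite_supp[OF assms(1,2)], of "Pair i"] by (simp add: vimage_def inj_on_def)
  have "a (i, k) \<le> (\<Sum>k\<in>{k. (i, k) \<in> supp a}. a (i, k))"
    using fin assms(3) x by (intro member_le_sum) auto
  also have "\<dots> \<le> n" using assms(2) i unfolding is_pattern_def by blast
  finally show ?thesis using x by simp
qed

text \<open>The interval of admissible ratios is closed under inversion; the edge itself supplies
  \<open>h \<ge> 1\<close>, so the weights are positive.\<close>

lemma Gamma_adj_sym: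
  assumes "regular_graph d h adjH" "n \<ge> 1" "d \<ge> 1" "Gamma_adj d n h adjH x y"
  shows "Gamma_adj d n h adjH y x"
proof -
  have adj: "adjH (fst x) (fst y)" using assms(4) by (simp add: Gamma_adj_def)
  then have h: "h \<ge> 1" and adj': "adjH (fst y) (fst x)"
    using assms(1) unfolding regular_graph_def by fastforce+
  have "wt n h (snd x) > 0" "wt n h (snd y) > 0" using wt_pos assms h by auto
  then show ?thesis using assms adj' unfolding Gamma_adj_def by (auto simp: field_simps)
qed

text \<open>Double counting: each \<open>y\<close> lies over a vertex of \<open>H\<close> with
  \<open>d\<close> neighbours \<open>i\<close>, so it is summed \<open>d\<close> times.\<close>

lemma sum_neighbour_weights:
  fixes f :: "nat \<times> nat \<Rightarrow> real"
  assumes "regular_graph d h adjH" "finite S" "\<And>x. x \<in> S \<Longrightarrow> fst x < h"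
  shows "(\<Sum>i<h. \<Sum>y\<in>{y\<in>S. adjH i (fst y)}. f y) = real d * (\<Sum>y\<in>S. f y)"
proof -
  have "(\<Sum>i<h. \<Sum>y\<in>{y\<in>S. adjH i (fst y)}. f y) = (\<Sum>i<h. \<Sum>y\<in>S. if adjH i (fst y) then f y else 0)"
    using assms(2) by (simp add: sum.inter_filter)
  also have "\<dots> = (\<Sum>y\<in>S. \<Sum>i<h. if adjH i (fst y) then f y else 0)" by (rule sum.swap)
  also have "\<dots> = (\<Sum>y\<in>S. real d * f y)"
  proof (intro sum.cong refl)
    fix y assume y: "y \<in> S"
    have "{i\<in>{..<h}. adjH i (fst y)} = {i. adjH (fst y) i}"
      using assms(1) unfolding regular_graph_def by blast
    moreover have "card {i. adjH (fst y) i} = d"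
      using assms(1) assms(3)[OF y] unfolding regular_graph_def by blast
    ultimately have "card {i\<in>{..<h}. adjH i (fst y)} = d" by simp
    then show "(\<Sum>i<h. if adjH i (fst y) then f y else 0) = real d * f y"
      by (simp flip: sum.inter_filter)
  qed
  finally show ?thesis by (simp add: sum_distrib_left)
qed

text \<open>\<open>T\<close> depends only on the fibre, so the dyadic estimate applies fibre by
  fibre and leaves \<open>6 * sqrt (s i)\<close>. Cauchy-Schwarz over the fibres then uses that
  \<open>s\<close> sums to at most \<open>10\<close> and \<open>T\<close> to at most
  \<open>10 * d\<close>.\<close>

lemma total_loss_le:
  assumes reg: "regular_graph d h adjH" and n: "n \<ge> 1" and pat: "is_pattern d n h adjH a e" and \<kappa>: "\<kappa> \<ge> 0"
  defines "w \<equiv> \<lambda>x. wt n h (snd x)"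
  defines "T \<equiv> \<lambda>i. \<Sum>y\<in>{y\<in>supp a. adjH i (fst y)}. (w y)\<^sup>2 * real (a y)"
  shows "(\<Sum>x\<in>supp a. 4 * \<kappa> * sqrt d * (w x)\<^sup>2 * real (a x) +
       sqrt (32 * \<kappa> * T (fst x)) * (w x * sqrt (a x) * sqrt (sqrt (real (a x) / real n))))
     \<le> 40 * \<kappa> * sqrt d + 60 * sqrt (32 * \<kappa>) * sqrt d"
proof -
  note fin = pattern_finite_supp[OF n pat]
  note less = pattern_fst_less[OF n pat]
  define K where "K = (\<lambda>i. {k. (i, k) \<in> supp a})"
  define s where "s = (\<lambda>i. \<Sum>k\<in>K i. (w (i, k))\<^sup>2 * real (a (i, k)))"
  have finK: "finite (K i)" for i
    using finite_vimageI[OF fin, of "Pair i"] by (simp add: K_def vimage_def inj_on_def)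
  have suppK: "supp a = Sigma {..<h} K" using less by (auto simp: K_def)
  have ten: "(\<Sum>x\<in>supp a. (w x)\<^sup>2 * real (a x)) \<le> 10"
    using pat by (simp add: is_pattern_def w_def)
  have sums: "(\<Sum>i<h. s i) \<le> 10"
    using ten finK unfolding s_def suppK by (subst sum.Sigma) (auto simp: case_prod_beta)
  have T0: "T i \<ge> 0" for i unfolding T_def by (intro sum_nonneg) auto
  have s0: "s i \<ge> 0" for i unfolding s_def by (intro sum_nonneg) auto
  have sumT: "(\<Sum>i<h. T i) \<le> 10 * real d"
    unfolding T_def using ten by (subst sum_neighbour_weights[OF reg fin less]) (auto simp: mult_left_mono mult.commute)
  have row: "(\<Sum>k\<in>K i. w (i, k) * sqrt (a (i, k)) * sqrt (sqrt (real (a (i, k)) / real n))) \<le> 6 * sqrt (s i)"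
    if "i < h" for i
  proof -
    define w0 where "w0 = 1 / sqrt (real n * real h)"
    have w: "w (i, k) = w0 * 2 ^ k" for k by (simp add: w_def wt_def w0_def)
    have "w0 > 0" using that n by (simp add: w0_def)
    moreover have "0 < real (a (i, k)) \<and> real (a (i, k)) \<le> real n" if "k \<in> K i" for k
      using that pattern_le[OF n pat, of "(i, k)"] by (simp add: K_def supp_def)
    ultimately show ?thesis
      unfolding w using n finK[of i] by (intro sum_dyadic_weights_le) (auto simp: s_def w)
  qed
  have "(\<Sum>x\<in>supp a. sqrt (32 * \<kappa> * T (fst x)) * (w x * sqrt (a x) * sqrt (sqrt (real (a x) / real n))))
     = (\<Sum>i<h. \<Sum>k\<in>K i. sqrt (32 * \<kappa> * T i) * (w (i, k) * sqrt (a (i, k)) * sqrt (sqrt (real (a (i, k)) / real n))))"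
    unfolding suppK using finK by (subst sum.Sigma) (auto simp: case_prod_beta)
  also have "\<dots> = (\<Sum>i<h. sqrt (32 * \<kappa> * T i) * (\<Sum>k\<in>K i. w (i, k) * sqrt (a (i, k)) * sqrt (sqrt (real (a (i, k)) / real n))))"
    by (simp add: sum_distrib_left)
  also have "\<dots> \<le> (\<Sum>i<h. sqrt (32 * \<kappa> * T i) * (6 * sqrt (s i)))"
    using T0 \<kappa> by (intro sum_mono mult_left_mono row) auto
  also have "\<dots> = 6 * sqrt (32 * \<kappa>) * (\<Sum>i<h. sqrt (T i) * sqrt (s i))"
    by (simp add: sum_distrib_left real_sqrt_mult mult_ac)
  also have "\<dots> \<le> 6 * sqrt (32 * \<kappa>) * (sqrt (\<Sum>i<h. (sqrt (T i))\<^sup>2) * sqrt (\<Sum>i<h. (sqrt (s i))\<^sup>2))"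
    using \<kappa> by (intro mult_left_mono sum_mult_le_sqrt) auto
  also have "\<dots> \<le> 6 * sqrt (32 * \<kappa>) * (sqrt (10 * real d) * sqrt 10)"
    using \<kappa> T0 s0 sums sumT by (intro mult_left_mono mult_mono real_sqrt_le_mono) (auto intro!: sum_nonneg)
  also have "sqrt (10 * real d) * sqrt 10 = 10 * sqrt d"
    by (simp add: real_sqrt_mult)
  finally have quad: "(\<Sum>x\<in>supp a. sqrt (32 * \<kappa> * T (fst x)) * (w x * sqrt (a x) * sqrt (sqrt (real (a x) / real n))))
    \<le> 60 * sqrt (32 * \<kappa>) * sqrt d" by simp
  have "(\<Sum>x\<in>supp a. 4 * \<kappa> * sqrt d * (w x)\<^sup>2 * real (a x)) = 4 * \<kappa> * sqrt d * (\<Sum>x\<in>supp a. (w x)\<^sup>2 * real (a x))"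
    by (simp add: sum_distrib_left mult_ac)
  also have "\<dots> \<le> 4 * \<kappa> * sqrt d * 10" using ten \<kappa> by (intro mult_left_mono) auto
  finally show ?thesis using quad by (simp add: sum.distrib)
qed

lemma potent_subset_exists:
  assumes d: "d \<ge> 2" and reg: "regular_graph d h adjH" and L: "L \<ge> 20"
    and n: "n \<ge> 1" and pat: "is_pattern d n h adjH a e"
  obtains S where "S \<subseteq> supp a"
    "potency d n h adjH (sub_a S a) (sub_e S e) \<ge> potency d n h adjH a e - 150 * L * sqrt (real d)"
    "\<And>x. x \<in> S \<Longrightarrow> L / 4 * real (a x) * (1 + ln (real n / real (a x))) \<le>
       (\<Sum>y\<in>{y\<in>S. Gamma_adj d n h adjH x y}. rate (real (e x y)) (real (a x) * real (a y) / real n))"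
proof -
  note fin = pattern_finite_supp[OF n pat]
  define w where "w = (\<lambda>x::nat \<times> nat. wt n h (snd x))"
  define \<mu> where "\<mu> = (\<lambda>x y. real (a x) * real (a y) / real n)"
  define v where "v = (\<lambda>x y. w x * w y * (real (e x y) - \<mu> x y))"
  define T where "T = (\<lambda>i. \<Sum>y\<in>{y\<in>supp a. adjH i (fst y)}. (w y)\<^sup>2 * real (a y))"
  \<comment> \<open>In the total rate each edge is seen from both its ends; the threshold
    \<open>L / 4\<close> per vertex therefore leaves \<open>L / 8\<close> in the exponent.\<close>
  define \<kappa> where "\<kappa> = L / 4"
  define loss where "loss = (\<lambda>x. 4 * \<kappa> * sqrt d * (w x)\<^sup>2 * real (a x) +
       sqrt (32 * \<kappa> * T (fst x)) * (w x * sqrt (a x) * sqrt (sqrt (real (a x) / real n))))"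
  define good where "good = (\<lambda>S x. \<kappa> * real (a x) * (1 + ln (real n / real (a x))) \<le>
       (\<Sum>y\<in>{y\<in>S. Gamma_adj d n h adjH x y}. rate (real (e x y)) (\<mu> x y)))"
  let ?adj = "Gamma_adj d n h adjH"
  define W where "W = (\<lambda>S. \<Sum>(x, y)\<in>{(x, y). x \<in> S \<and> y \<in> S \<and> ?adj x y}. v x y)"
  have \<kappa>: "\<kappa> \<ge> 0" using L by (simp add: \<kappa>_def)
  have "\<exists>S\<subseteq>supp a. (\<forall>x\<in>S. good S x) \<and> \<bar>W (supp a)\<bar> \<le> \<bar>W S\<bar> + 2 * (\<Sum>x\<in>supp a - S. loss x)"
    unfolding W_def
  proof (rule greedy_removal[OF _ _ fin])
    fix x y assume xy: "?adj x y"
    have "e x y = e y x" using pat xy unfolding is_pattern_def by blast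
    then show "?adj y x \<and> v y x = v x y"
      using Gamma_adj_sym[OF reg n _ xy] d by (simp add: v_def \<mu>_def mult_ac)
  next
    fix x show "\<not> ?adj x x" using reg unfolding regular_graph_def Gamma_adj_def by blast
  next
    fix S x assume S: "S \<subseteq> supp a" and x: "x \<in> S" and bad: "\<not> good S x"
    let ?Y = "{y\<in>S. ?adj x y}"
    have xs: "x \<in> supp a" using S x by auto
    have h: "h \<ge> 1" using pattern_fst_less[OF n pat xs] by simp
    have w: "w y > 0" for y using wt_pos[OF n h] by (simp add: w_def)
    have "(\<Sum>y\<in>?Y. w x * w y * \<bar>real (e x y) - real (a x) * real (a y) / real n\<bar>) \<le>
      4 * \<kappa> * sqrt d * (w x)\<^sup>2 * real (a x) + sqrt (32 * \<kappa> * T (fst x)) * (w x * sqrt (a x) * sqrt (sqrt (real (a x) / real n)))"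
    proof (rule vertex_loss_le)
      show "finite ?Y" using finite_subset[OF S fin] by simp
      show "real n > 0" using n by simp
      show "0 < real (a x)" using xs by (simp add: supp_def)
      show "real (a x) \<le> real n" using pattern_le[OF n pat xs] by simp
      show "w x > 0" "sqrt d \<ge> 0" "\<kappa> \<ge> 0" using w \<kappa> by auto
    next
      fix y assume y: "y \<in> ?Y"
      \<comment> \<open>The lower end of the admissible weight ratios supplies
        \<open>D = sqrt d\<close>.\<close>
      then have "w x / w y > 1 / sqrt d" by (simp add: Gamma_adj_def w_def)
      then have "w y \<le> sqrt d * w x" using w[of x] w[of y] d by (simp add: field_simps)
      then show "w y > 0 \<and> w y \<le> sqrt d * w x \<and> real (a y) > 0 \<and> real (e x y) \<ge> 0"
        using w y S by (auto simp: supp_def)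
    next
      show "(\<Sum>y\<in>?Y. (w y)\<^sup>2 * real (a y)) \<le> T (fst x)"
        unfolding T_def using fin S by (intro sum_mono2) (auto simp: Gamma_adj_def)
      show "(\<Sum>y\<in>?Y. rate (real (e x y)) (real (a x) * real (a y) / real n)) \<le>
          \<kappa> * real (a x) * (1 + ln (real n / real (a x)))"
        using bad by (simp add: good_def \<mu>_def)
    qed
    moreover have "\<bar>v x y\<bar> = w x * w y * \<bar>real (e x y) - real (a x) * real (a y) / real n\<bar>" for y
      using w[of x] w[of y] by (simp add: v_def \<mu>_def abs_mult)
    ultimately show "(\<Sum>y\<in>?Y. \<bar>v x y\<bar>) \<le> loss x" by (simp add: loss_def)
  qed
  then obtain S where S: "S \<subseteq> supp a" "\<forall>x\<in>S. good S x"
    "\<bar>W (supp a)\<bar> \<le> \<bar>W S\<bar> + 2 * (\<Sum>x\<in>supp a - S. loss x)" by blast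
  have w0: "w x \<ge> 0" for x by (simp add: w_def wt_def)
  have T0: "T i \<ge> 0" for i unfolding T_def by (intro sum_nonneg) auto
  have loss0: "loss x \<ge> 0" for x
    unfolding loss_def using \<kappa> w0[of x] T0[of "fst x"] by (intro add_nonneg_nonneg mult_nonneg_nonneg) auto
  have "(\<Sum>x\<in>supp a - S. loss x) \<le> (\<Sum>x\<in>supp a. loss x)"
    using fin loss0 by (intro sum_mono2) auto
  also have "\<dots> \<le> 40 * \<kappa> * sqrt d + 60 * sqrt (32 * \<kappa>) * sqrt d"
    unfolding loss_def T_def w_def by (rule total_loss_le[OF reg n pat \<kappa>])
  also have "\<dots> \<le> 150 * L * sqrt d"
  proof -
    \<comment> \<open>Since \<open>32 * \<kappa> = 8 * L\<close>, this bounds the square root by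
      \<open>L\<close>; altogether the loss is at most \<open>70 * L * sqrt d\<close>.\<close>
    have "8 * L \<le> L\<^sup>2" using L by (simp add: power2_eq_square)
    then have "sqrt (32 * \<kappa>) \<le> L" using L by (simp add: \<kappa>_def real_le_lsqrt)
    then have "60 * sqrt (32 * \<kappa>) * sqrt d \<le> 60 * L * sqrt d" by (intro mult_right_mono) auto
    moreover have "70 * L * sqrt d \<le> 150 * L * sqrt d" using L by (intro mult_right_mono) auto
    moreover have "40 * \<kappa> * sqrt d = 10 * L * sqrt d" by (simp add: \<kappa>_def)
    ultimately show ?thesis by linarith
  qed
  finally have tot: "(\<Sum>x\<in>supp a - S. loss x) \<le> 150 * L * sqrt d" .
  \<comment> \<open>Potency halves the sum over ordered pairs, which cancels the factor
    \<open>2\<close> of \<open>greedy_removal\<close>.\<close>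
  have pot: "potency d n h adjH a e = \<bar>W (supp a)\<bar> / 2"
    by (simp add: potency_def W_def v_def w_def \<mu>_def abs_mult)
  have suppS: "supp (sub_a S a) = S" using S(1) by (auto simp: supp_def sub_a_def)
  have "(\<Sum>(x, y)\<in>{(x, y). x \<in> S \<and> y \<in> S \<and> ?adj x y}.
        wt n h (snd x) * wt n h (snd y) * (real (sub_e S e x y) - real (sub_a S a x) * real (sub_a S a y) / real n)) = W S"
    unfolding W_def by (intro sum.cong) (auto simp: v_def w_def \<mu>_def sub_a_def sub_e_def)
  then have potS: "potency d n h adjH (sub_a S a) (sub_e S e) = \<bar>W S\<bar> / 2"
    unfolding potency_def suppS by (simp add: abs_mult)
  show ?thesis
  proof (rule that[OF S(1)])
    show "potency d n h adjH (sub_a S a) (sub_e S e) \<ge> potency d n h adjH a e - 150 * L * sqrt (real d)"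
      unfolding pot potS using S(3) tot by simp
  qed (use S(2) in \<open>simp add: good_def \<kappa>_def \<mu>_def\<close>)
qed

section \<open>Probability of finding a pattern\<close>

text \<open>\<open>H\<close> has no loops, so every edge of \<open>\<Gamma>\<close> joins two
  different fibres and has exactly one orientation with \<open>fst x < fst y\<close>, the one under
  which a lift stores its permutations.\<close>

lemma sum_Gamma_half:
  assumes reg: "regular_graph d h adjH" and n: "n \<ge> 1" and d: "d \<ge> 1" and S: "finite S"
    and sym: "\<And>x y. Gamma_adj d n h adjH x y \<Longrightarrow> f x y = (f y x :: real)"
  shows "(\<Sum>x\<in>S. \<Sum>y\<in>{y\<in>S. Gamma_adj d n h adjH x y}. f x y)
    = 2 * (\<Sum>(x, y)\<in>{(x, y). x \<in> S \<and> y \<in> S \<and> Gamma_adj d n h adjH x y \<and> fst x < fst y}. f x y)"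
proof -
  let ?adj = "Gamma_adj d n h adjH"
  let ?U = "{(x, y). x \<in> S \<and> y \<in> S \<and> ?adj x y \<and> fst x < fst y}"
  let ?V = "{(x, y). x \<in> S \<and> y \<in> S \<and> ?adj x y \<and> fst y < fst x}"
  have adj_sym: "?adj x y \<Longrightarrow> ?adj y x" for x y using Gamma_adj_sym[OF reg n d] .
  have ne: "fst x \<noteq> fst y" if "?adj x y" for x y
    using that reg unfolding regular_graph_def Gamma_adj_def by blast
  have fin: "finite ?U" "finite ?V"
    by (rule finite_subset[of _ "S \<times> S"]; use S in auto)+
  have "(\<Sum>x\<in>S. \<Sum>y\<in>{y\<in>S. ?adj x y}. f x y) = (\<Sum>(x, y)\<in>Sigma S (\<lambda>x. {y\<in>S. ?adj x y}). f x y)"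
    using S by (subst sum.Sigma) auto
  also have "Sigma S (\<lambda>x. {y\<in>S. ?adj x y}) = ?U \<union> ?V" using ne by (auto simp: neq_iff)
  also have "(\<Sum>(x, y)\<in>?U \<union> ?V. f x y) = (\<Sum>(x, y)\<in>?U. f x y) + (\<Sum>(x, y)\<in>?V. f x y)"
    using fin by (intro sum.union_disjoint) auto
  also have "(\<Sum>(x, y)\<in>?V. f x y) = (\<Sum>(x, y)\<in>?U. f x y)"
    by (rule sum.reindex_bij_witness[of _ prod.swap prod.swap]) (auto dest: adj_sym sym)
  finally show ?thesis by simp
qed

text \<open>The factor \<open>z y\<close> occurs once for each edge of \<open>H\<close> whose larger
  end is the fibre of \<open>y\<close>. There are at most \<open>d\<close> of these, and
  \<open>z y \<ge> 1\<close> allows the exponent to be raised to \<open>d\<close>.\<close>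

lemma prod_prod_edges_le:
  fixes z :: "nat \<times> nat \<Rightarrow> real"
  assumes reg: "regular_graph d h adjH" and S: "finite S" "S \<subseteq> {0..<h} \<times> UNIV"
    and z: "\<And>x. x \<in> S \<Longrightarrow> z x \<ge> 1"
  shows "(\<Prod>p\<in>{(i, i'). adjH i i' \<and> i < i'}. \<Prod>y\<in>{y\<in>S. fst y = snd p}. z y) \<le> (\<Prod>y\<in>S. z y ^ d)"
proof -
  let ?E = "{(i, i'). adjH i i' \<and> i < i'}"
  have finE: "finite ?E"
    by (rule finite_subset[of _ "{0..<h} \<times> {0..<h}"]) (use reg in \<open>auto simp: regular_graph_def\<close>)
  have "(\<Prod>p\<in>?E. \<Prod>y\<in>{y\<in>S. fst y = snd p}. z y) = (\<Prod>p\<in>?E. \<Prod>y\<in>S. if fst y = snd p then z y else 1)"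
    using S(1) by (simp add: prod.inter_filter)
  also have "\<dots> = (\<Prod>y\<in>S. \<Prod>p\<in>?E. if fst y = snd p then z y else 1)" by (rule prod.swap)
  also have "\<dots> = (\<Prod>y\<in>S. z y ^ card {p\<in>?E. fst y = snd p})"
    using finE by (simp flip: prod.inter_filter)
  also have "\<dots> \<le> (\<Prod>y\<in>S. z y ^ d)"
  proof (intro prod_mono conjI)
    fix y assume y: "y \<in> S"
    have "fst y < h" using S(2) y by auto
    then have nb: "card {i. adjH (fst y) i} = d" using reg unfolding regular_graph_def by blast
    have "finite {i. adjH (fst y) i}"
      by (rule finite_subset[of _ "{0..<h}"]) (use reg in \<open>auto simp: regular_graph_def\<close>)
    then have "card {p\<in>?E. fst y = snd p} \<le> card {i. adjH (fst y) i}"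
      using reg by (intro card_inj_on_le[of fst]) (auto simp: inj_on_def regular_graph_def)
    then show "z y ^ card {p\<in>?E. fst y = snd p} \<le> z y ^ d"
      using z[OF y] nb by (intro power_increasing) auto
    show "0 \<le> z y ^ card {p\<in>?E. fst y = snd p}" using z[OF y] by simp
  qed
  finally show ?thesis .
qed

text \<open>Union bound over the families of vertex sets. For a fixed family the conditions on
  different edges of \<open>H\<close> concern different coordinates of the lift, so the number of
  good lifts is a product over those edges.\<close>

lemma prob_found_le:
  assumes reg: "regular_graph d h adjH" and n: "n \<ge> 1" and d: "d \<ge> 1"
    and S: "finite S" "S \<subseteq> {0..<h} \<times> UNIV" "\<And>x. x \<in> S \<Longrightarrow> a x > 0"
    and sym: "\<And>x y. Gamma_adj d n h adjH x y \<Longrightarrow> e x y = e y x"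
  shows "prob_found d n h adjH (sub_a S a) (sub_e S e) \<le>
    (\<Prod>x\<in>S. real (n choose a x)) * (\<Prod>x\<in>S. (exp 1 * real (a x)) ^ d) *
    exp (- (\<Sum>x\<in>S. \<Sum>y\<in>{y\<in>S. Gamma_adj d n h adjH x y}. rate (real (e x y)) (real (a x) * real (a y) / real n)) / 2)"
proof -
  let ?adj = "Gamma_adj d n h adjH"
  let ?N = "{0..<n}"
  define EH where "EH = {(i, i'). adjH i i' \<and> i < i'}"
  define P where "P = {f. f permutes ?N}"
  define I where "I = (\<lambda>x y. rate (real (e x y)) (real (a x) * real (a y) / real n))"
  define E where "E = (\<lambda>p. {(x, y). x \<in> S \<and> y \<in> S \<and> fst x = fst p \<and> fst y = snd p \<and> ?adj x y})"
  \<comment> \<open>Outside \<open>S\<close> the sub-pattern forces empty sets, so families are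
    recorded on \<open>S\<close> only; as extensional functions they form a finite set.\<close>
  define \<A> where "\<A> = {A \<in> PiE S (\<lambda>x. {B. B \<subseteq> ?N \<and> card B = a x}). \<forall>x\<in>S. \<forall>y\<in>S. fst x = fst y \<longrightarrow> x \<noteq> y \<longrightarrow> A x \<inter> A y = {}}"
  define Good where "Good = (\<lambda>A. PiE EH (\<lambda>p. {\<sigma>. \<sigma> permutes ?N \<and> (\<forall>(x, y)\<in>E p. card {j\<in>A x. \<sigma> j \<in> A y} = e x y)}))"
  define \<Omega> where "\<Omega> = lift_space n adjH"
  define F where "F = {\<sigma>. found_in d n h adjH (sub_a S a) (sub_e S e) \<sigma>}"
  have finEH: "finite EH" unfolding EH_def
    by (rule finite_subset[of _ "{0..<h} \<times> {0..<h}"]) (use reg in \<open>auto simp: regular_graph_def\<close>)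
  have finP: "finite P" unfolding P_def by (intro finite_permutations) auto
  have \<Omega>: "\<Omega> = PiE EH (\<lambda>_. P)" by (simp add: \<Omega>_def lift_space_def EH_def P_def)
  have fin\<Omega>: "finite \<Omega>" unfolding \<Omega> using finEH finP by (intro finite_PiE) auto
  have "id \<in> P" by (simp add: P_def permutes_id)
  then have ne\<Omega>: "\<Omega> \<noteq> {}" unfolding \<Omega> by (auto simp: PiE_eq_empty_iff)
  have card\<Omega>: "real (card \<Omega>) = fact n ^ card EH"
    unfolding \<Omega> using finEH by (simp add: card_PiE P_def card_permutations)
  have finPi: "finite (PiE S (\<lambda>x. {B. B \<subseteq> ?N \<and> card B = a x}))"
    using S(1) by (intro finite_PiE) auto
  then have fin\<A>: "finite \<A>" unfolding \<A>_def by simp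
  \<comment> \<open>Dropping disjointness enlarges the set and leaves a product of binomial
    coefficients.\<close>
  have "card \<A> \<le> card (PiE S (\<lambda>x. {B. B \<subseteq> ?N \<and> card B = a x}))"
    unfolding \<A>_def by (intro card_mono finPi) auto
  also have "\<dots> = (\<Prod>x\<in>S. n choose a x)"
    using S(1) by (simp add: card_PiE n_subsets)
  finally have card\<A>: "real (card \<A>) \<le> (\<Prod>x\<in>S. real (n choose a x))"
    by (simp flip: of_nat_prod)
  have cover: "\<Omega> \<inter> F \<subseteq> (\<Union>A\<in>\<A>. Good A)"
  proof
    fix \<sigma> assume \<sigma>: "\<sigma> \<in> \<Omega> \<inter> F"
    then have "found_in d n h adjH (sub_a S a) (sub_e S e) \<sigma>" by (simp add: F_def)
    then obtain A where A: "\<forall>x. A x \<subseteq> ?N \<and> card (A x) = sub_a S a x"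
      "\<forall>i k k'. k \<noteq> k' \<longrightarrow> A (i, k) \<inter> A (i, k') = {}"
      "\<forall>x y. ?adj x y \<longrightarrow>
           card {(j, j'). j \<in> A x \<and> j' \<in> A y \<and> lift_adj adjH \<sigma> (fst x, j) (fst y, j')} = sub_e S e x y"
      unfolding found_in_def by (elim exE conjE)
    have "A x \<inter> A y = {}" if "fst x = fst y" "x \<noteq> y" for x y
      using A(2) that by (metis prod.collapse)
    then have "restrict A S \<in> \<A>"
      unfolding \<A>_def using A(1) by (simp add: sub_a_def Pi_def)
    moreover have "\<sigma> \<in> Good (restrict A S)"
      unfolding Good_def
    proof (rule PiE_I)
      fix p assume p: "p \<in> EH"
      have "card {j \<in> restrict A S x. \<sigma> p j \<in> restrict A S y} = e x y" if "(x, y) \<in> E p" for x y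
      proof -
        have xy: "x \<in> S" "y \<in> S" "?adj x y" "p = (fst x, fst y)" "fst x < fst y" "adjH (fst x) (fst y)"
          using that p by (auto simp: E_def EH_def)
        \<comment> \<open>As \<open>fst x < fst y\<close>, the permutation at \<open>p\<close> maps
          the fibre of \<open>x\<close> to that of \<open>y\<close>, so the lift edges in question
          are counted by their first coordinates.\<close>
        have "{(j, j'). j \<in> A x \<and> j' \<in> A y \<and> lift_adj adjH \<sigma> (fst x, j) (fst y, j')}
          = (\<lambda>j. (j, \<sigma> p j)) ` {j \<in> A x. \<sigma> p j \<in> A y}"
          using xy by (auto simp: lift_adj_def)
        then have "card {j \<in> A x. \<sigma> p j \<in> A y} = sub_e S e x y"
          using A(3)[rule_format, OF xy(3)] by (simp add: card_image inj_on_def)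
        then show ?thesis using xy by (simp add: sub_e_def)
      qed
      moreover have "\<sigma> p permutes ?N" using \<sigma> p PiE_mem[of \<sigma> EH "\<lambda>_. P" p] by (simp add: \<Omega> P_def)
      ultimately show "\<sigma> p \<in> {\<sigma>. \<sigma> permutes ?N \<and> (\<forall>(x, y)\<in>E p. card {j \<in> restrict A S x. \<sigma> j \<in> restrict A S y} = e x y)}"
        by blast
    next
      fix p assume "p \<notin> EH"
      then show "\<sigma> p = undefined" using \<sigma> by (auto simp: \<Omega>)
    qed
    ultimately show "\<sigma> \<in> (\<Union>A\<in>\<A>. Good A)" by blast
  qed
  have finE: "finite (E p)" for p
    unfolding E_def by (rule finite_subset[of _ "S \<times> S"]) (use S in auto)
  have edge: "real (card {\<sigma>. \<sigma> permutes ?N \<and> (\<forall>(x, y)\<in>E p. card {j\<in>A x. \<sigma> j \<in> A y} = e x y)})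
      \<le> fact n * (\<Prod>y\<in>{y\<in>S. fst y = snd p}. exp 1 * real (a y)) * exp (- (\<Sum>(x, y)\<in>E p. I x y))"
    if A: "A \<in> \<A>" for A p
  proof -
    have sub: "A x \<subseteq> ?N" "card (A x) = a x" "A x \<noteq> {}" if "x \<in> S" for x
      using A that S(3)[OF that] unfolding \<A>_def by (auto dest!: PiE_mem)
    have dj: "disjoint_family_on A {x\<in>S. fst x = i}" for i
      using A unfolding \<A>_def disjoint_family_on_def by auto
    have "real (card {\<sigma>. \<sigma> permutes ?N \<and> (\<forall>(x, y)\<in>E p. card {j\<in>A x. \<sigma> j \<in> A y} = e x y)})
      \<le> fact n * (\<Prod>y\<in>{y\<in>S. fst y = snd p}. exp 1 * real (card (A y))) *
         exp (- (\<Sum>(x, y)\<in>E p. rate (real (e x y)) (real (card (A x)) * real (card (A y)) / real n)))"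
      using S(1) sub dj n
      by (intro card_permutes_prescribed_counts_le[where X = "{x\<in>S. fst x = fst p}"]) (auto simp: E_def)
    also have "(\<Sum>(x, y)\<in>E p. rate (real (e x y)) (real (card (A x)) * real (card (A y)) / real n)) = (\<Sum>(x, y)\<in>E p. I x y)"
      using sub by (intro sum.cong) (auto simp: E_def I_def)
    also have "(\<Prod>y\<in>{y\<in>S. fst y = snd p}. exp 1 * real (card (A y))) = (\<Prod>y\<in>{y\<in>S. fst y = snd p}. exp 1 * real (a y))"
      using sub by (intro prod.cong) auto
    finally show ?thesis .
  qed
  \<comment> \<open>The double sum meets each edge of \<open>\<Gamma>\<close> at both ends, hence
    the halving.\<close>
  have sumE: "(\<Sum>p\<in>EH. \<Sum>(x, y)\<in>E p. I x y) = (\<Sum>x\<in>S. \<Sum>y\<in>{y\<in>S. ?adj x y}. I x y) / 2"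
  proof -
    let ?U = "{(x, y). x \<in> S \<and> y \<in> S \<and> ?adj x y \<and> fst x < fst y}"
    have "I x y = I y x" if "?adj x y" for x y
      using sym[OF that] by (simp add: I_def mult.commute)
    then have "(\<Sum>x\<in>S. \<Sum>y\<in>{y\<in>S. ?adj x y}. I x y) = 2 * (\<Sum>(x, y)\<in>?U. I x y)"
      by (intro sum_Gamma_half[OF reg n d S(1)])
    moreover have "(\<Sum>(x, y)\<in>?U. I x y) = (\<Sum>p\<in>EH. \<Sum>(x, y)\<in>E p. I x y)"
    proof -
      have "?U = (\<Union>p\<in>EH. E p)"
        by (auto simp: EH_def E_def Gamma_adj_def)
      moreover have "E p \<inter> E q = {}" if "p \<noteq> q" for p q
        using that by (auto simp: E_def prod_eq_iff)
      ultimately show ?thesis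
        using finEH finE by (simp add: sum.UNION_disjoint)
    qed
    ultimately show ?thesis by simp
  qed
  define R where "R = (\<Prod>x\<in>S. (exp 1 * real (a x)) ^ d) * exp (- (\<Sum>x\<in>S. \<Sum>y\<in>{y\<in>S. ?adj x y}. I x y) / 2)"
  have good: "real (card (Good A)) \<le> fact n ^ card EH * R" if A: "A \<in> \<A>" for A
  proof -
    have "real (card (Good A)) = (\<Prod>p\<in>EH. real (card {\<sigma>. \<sigma> permutes ?N \<and> (\<forall>(x, y)\<in>E p. card {j\<in>A x. \<sigma> j \<in> A y} = e x y)}))"
      unfolding Good_def using finEH by (simp add: card_PiE)
    also have "\<dots> \<le> (\<Prod>p\<in>EH. fact n * (\<Prod>y\<in>{y\<in>S. fst y = snd p}. exp 1 * real (a y)) * exp (- (\<Sum>(x, y)\<in>E p. I x y)))"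
      by (intro prod_mono conjI edge A) auto
    also have "\<dots> = fact n ^ card EH * (\<Prod>p\<in>EH. \<Prod>y\<in>{y\<in>S. fst y = snd p}. exp 1 * real (a y)) *
        exp (- (\<Sum>p\<in>EH. \<Sum>(x, y)\<in>E p. I x y))"
      using finEH by (simp add: prod.distrib exp_sum flip: sum_negf)
    also have "\<dots> \<le> fact n ^ card EH * (\<Prod>x\<in>S. (exp 1 * real (a x)) ^ d) * exp (- (\<Sum>p\<in>EH. \<Sum>(x, y)\<in>E p. I x y))"
    proof -
      have "exp 1 * real (a x) \<ge> 1" if "x \<in> S" for x
        using S(3)[OF that] mult_mono[of 1 "exp 1" 1 "real (a x)"] by simp
      then show ?thesis
        unfolding EH_def using reg S(1,2) by (intro mult_right_mono mult_left_mono prod_prod_edges_le) auto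
    qed
    finally show ?thesis unfolding sumE R_def by (simp add: mult_ac)
  qed
  have finGood: "finite (Good A)" for A
    unfolding Good_def using finEH finP by (intro finite_PiE) (auto simp: P_def intro: finite_subset)
  have R0: "R \<ge> 0" unfolding R_def by (intro mult_nonneg_nonneg prod_nonneg) auto
  have "real (card (\<Omega> \<inter> F)) \<le> real (card (\<Union>A\<in>\<A>. Good A))"
    using cover fin\<A> finGood by (intro of_nat_mono card_mono) auto
  also have "\<dots> \<le> (\<Sum>A\<in>\<A>. real (card (Good A)))"
    using card_UN_le[OF fin\<A>, of Good] by (simp flip: of_nat_sum)
  also have "\<dots> \<le> (\<Sum>A\<in>\<A>. fact n ^ card EH * R)" by (intro sum_mono good)
  also have "\<dots> = real (card \<A>) * R * fact n ^ card EH" by simp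
  also have "\<dots> \<le> (\<Prod>x\<in>S. real (n choose a x)) * R * fact n ^ card EH"
    using card\<A> R0 by (intro mult_right_mono) auto
  finally have "real (card (\<Omega> \<inter> F)) / real (card \<Omega>) \<le> (\<Prod>x\<in>S. real (n choose a x)) * R"
    unfolding card\<Omega> by (simp add: divide_le_eq)
  moreover have "prob_found d n h adjH (sub_a S a) (sub_e S e) = real (card (\<Omega> \<inter> F)) / real (card \<Omega>)"
    unfolding prob_found_def F_def[symmetric] \<Omega>_def[symmetric] using ne\<Omega> fin\<Omega> by (rule measure_pmf_of_set)
  ultimately show ?thesis by (simp add: R_def I_def mult_ac)
qed

section \<open>Binomial coefficients against the exponent\<close>

lemma ln_binomial_min_le:
  assumes a: "1 \<le> a" "a \<le> n"
  shows "ln (real (n choose min a (n div 2))) \<le> real a * (1 + ln (real n / real a))"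
proof (cases "min a (n div 2) = 0")
  case True
  then show ?thesis using a by simp
next
  case False
  define m where "m = min a (n div 2)"
  have m: "1 \<le> m" "m \<le> a" "m \<le> n" using False a by (auto simp: m_def)
  \<comment> \<open>The left side is \<open>1\<close>, so this is
    \<open>m! \<ge> (m / e) ^ m\<close>, which leads to
    \<open>n choose m \<le> (e * n / m) ^ m\<close>.\<close>
  have "stirling_quot 0 \<le> stirling_quot m" by (rule stirling_quot_mono) simp
  then have "real m ^ m \<le> fact m * exp (real m)"
    using m by (simp add: stirling_quot_def field_simps)
  then have "real (n choose m) * real m ^ m \<le> real (n choose m) * (fact m * exp (real m))"
    by (intro mult_left_mono) auto
  also have "\<dots> = real ((n choose m) * fact m) * exp (real m)" by simp
  also have "\<dots> \<le> real (n ^ m) * exp (real m)"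
    by (intro mult_right_mono of_nat_mono binomial_fact_pow) auto
  finally have "real (n choose m) \<le> (real n / real m) ^ m * exp (real m)"
    using m by (simp add: field_simps power_divide)
  then have "ln (real (n choose m)) \<le> ln ((real n / real m) ^ m * exp (real m))"
    using m by (subst ln_le_cancel_iff) auto
  also have "\<dots> = real m * (1 + ln (real n / real m))"
    using m by (simp add: ln_mult ln_realpow algebra_simps)
  also have "\<dots> \<le> real a * (1 + ln (real n / real a))"
  proof -
    \<comment> \<open>Monotonicity of \<open>m * (1 + ln (n / m))\<close> for
      \<open>m \<le> a \<le> n\<close>, obtained from \<open>ln t \<le> t - 1\<close> at
      \<open>t = a / m\<close>.\<close>
    have "real m * ln (real a / real m) \<le> real m * (real a / real m - 1)"
      using m a by (intro mult_left_mono ln_le_minus_one) auto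
    then have 1: "real m * ln (real a / real m) \<le> real a - real m" using m by (simp add: algebra_simps)
    have "ln (real n / real m) = ln (real n / real a) + ln (real a / real m)"
      using m a by (simp add: ln_div)
    moreover have "0 \<le> (real a - real m) * ln (real n / real a)" using m a by (intro mult_nonneg_nonneg) auto
    ultimately show ?thesis using 1 by (simp add: algebra_simps)
  qed
  finally show ?thesis by (simp add: m_def)
qed

lemma binomial_le_binomial_min: "n choose a \<le> n choose min a (n div 2)"
  by (simp add: min_def binomial_maximum)

text \<open>The coefficient \<open>L / 8\<close> is spent as \<open>L / 10 + L / 40\<close>: the
  first part yields the negative power of the binomial coefficient, the second is at least
  \<open>1 / 2\<close> and cancels \<open>exp (a / 2)\<close>, which dominates \<open>a ^ d\<close>
  up to a constant.\<close>

lemma vertex_factor_le: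
  assumes a: "1 \<le> a" "a \<le> n" and L: "L \<ge> 20" and d: "d \<ge> 1"
  shows "real (n choose a) * (exp 1 * real a) ^ d * exp (- (L / 8 * real a * (1 + ln (real n / real a))))
    \<le> (2 * exp 1 * real d) ^ d * real (n choose min a (n div 2)) powr (1 - L / 10)"
proof -
  define B where "B = real (n choose min a (n div 2))"
  define l where "l = 1 + ln (real n / real a)"
  have B: "B > 0" unfolding B_def by simp
  have l: "l \<ge> 1" using a by (simp add: l_def)
  have lnB: "ln B \<le> real a * l" unfolding B_def l_def by (rule ln_binomial_min_le[OF a])
  \<comment> \<open>\<open>x \<le> exp x\<close> at \<open>x = a / (2 * d)\<close>, raised to the
    power \<open>d\<close>, trades \<open>a ^ d\<close> for \<open>exp (a / 2)\<close>.\<close>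
  have "(real a / (2 * real d)) ^ d \<le> exp (real a / (2 * real d)) ^ d"
    using exp_ge_add_one_self[of "real a / (2 * real d)"] by (intro power_mono) (linarith, simp)
  also have "\<dots> = exp (real a / 2)" using d by (simp flip: exp_of_nat_mult)
  finally have poly: "real a ^ d \<le> (2 * real d) ^ d * exp (real a / 2)"
    using d by (simp add: power_divide field_simps)
  have "L / 10 * ln B \<le> L / 10 * (real a * l)" using lnB L by (intro mult_left_mono) auto
  moreover have "real a / 2 * 1 \<le> (L / 40 * real a) * l"
    using L l a by (intro mult_mono) auto
  ultimately have "- (L / 8 * real a * l) \<le> - (L / 10) * ln B - real a / 2"
    by (simp add: field_simps)
  then have "exp (- (L / 8 * real a * l)) \<le> exp (- (L / 10) * ln B - real a / 2)" by simp
  also have "\<dots> = B powr (- (L / 10)) * exp (- (real a / 2))"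
    using B by (simp add: powr_def flip: exp_add)
  finally have expo: "exp (- (L / 8 * real a * l)) \<le> B powr (- (L / 10)) * exp (- (real a / 2))" .
  have "real (n choose a) * (exp 1 * real a) ^ d * exp (- (L / 8 * real a * l))
    \<le> B * (exp 1 ^ d * ((2 * real d) ^ d * exp (real a / 2))) * (B powr (- (L / 10)) * exp (- (real a / 2)))"
    using poly binomial_le_binomial_min[of n a] B expo unfolding power_mult_distrib
    by (intro mult_mono mult_nonneg_nonneg) (auto simp: B_def)
  also have "\<dots> = (2 * exp 1 * real d) ^ d * (B * B powr (- (L / 10))) * (exp (real a / 2) * exp (- (real a / 2)))"
    by (simp add: power_mult_distrib)
  also have "B * B powr (- (L / 10)) = B powr (1 - L / 10)"
    using B by (simp add: powr_diff powr_minus_divide)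
  also have "exp (real a / 2) * exp (- (real a / 2)) = 1" by (simp flip: exp_add)
  finally show ?thesis by (simp add: B_def l_def)
qed

theorem theorem6p2:
  fixes d h :: nat and adjH :: "nat \<Rightarrow> nat \<Rightarrow> bool" and L :: real
  assumes "d \<ge> 2" and "regular_graph d h adjH" and "L \<ge> 20"
  shows "\<exists>C :: real. \<forall>n :: nat. \<forall>a e. n \<ge> 1 \<longrightarrow> is_pattern d n h adjH a e \<longrightarrow>
     (\<exists>S \<subseteq> {0..<h} \<times> UNIV.
        potency d n h adjH (sub_a S a) (sub_e S e) \<ge> potency d n h adjH a e - 150 * L * sqrt (real d) \<and>
        prob_found d n h adjH (sub_a S a) (sub_e S e) \<le>
          C * (\<Prod>x\<in>{x\<in>S. a x > 0}. real (a x) powr (real d / 4)) *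
          (\<Prod>x\<in>{x\<in>S. a x > 0}. real (n choose min (a x) (n div 2))) powr (1 - L / 10))"
proof -
  define c where "c = (2 * exp 1 * real d) ^ d"
  have "1 \<le> 2 * exp (1::real)" using exp_ge_add_one_self[of "1::real"] by linarith
  then have "1 * 1 \<le> 2 * exp 1 * real d" using assms(1) by (intro mult_mono) auto
  then have c: "c \<ge> 1" by (simp add: c_def)
  show ?thesis
  \<comment> \<open>Each vertex of \<open>S\<close> costs one factor \<open>c\<close>, and
    \<open>S\<close> has at most \<open>h * d\<close> vertices whatever \<open>n\<close> and the
    pattern are; \<open>c \<ge> 1\<close> makes the larger power an upper bound.\<close>
  proof (rule exI[of _ "c ^ (h * d)"], intro allI impI)
    fix n :: nat and a :: "nat \<times> nat \<Rightarrow> nat" and e :: "nat \<times> nat \<Rightarrow> nat \<times> nat \<Rightarrow> nat"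
    assume n: "n \<ge> 1" and pat: "is_pattern d n h adjH a e"
    let ?adj = "Gamma_adj d n h adjH"
    let ?I = "\<lambda>x y. rate (real (e x y)) (real (a x) * real (a y) / real n)"
    let ?B = "\<lambda>x. real (n choose min (a x) (n div 2))"
    obtain S where S: "S \<subseteq> supp a"
      "potency d n h adjH (sub_a S a) (sub_e S e) \<ge> potency d n h adjH a e - 150 * L * sqrt (real d)"
      "\<And>x. x \<in> S \<Longrightarrow> L / 4 * real (a x) * (1 + ln (real n / real (a x))) \<le> (\<Sum>y\<in>{y\<in>S. ?adj x y}. ?I x y)"
      using potent_subset_exists[OF assms n pat] by blast
    have fin: "finite S" using pattern_finite_supp[OF n pat] S(1) finite_subset by blast
    have Sh: "S \<subseteq> {0..<h} \<times> UNIV" using pattern_fst_less[OF n pat] S(1) by fastforce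
    have a: "1 \<le> a x" "a x \<le> n" if "x \<in> S" for x
      using that S(1) pattern_le[OF n pat, of x] by (auto simp: supp_def Suc_le_eq)
    have filt: "{x\<in>S. a x > 0} = S" using S(1) by (auto simp: supp_def)
    have e_sym: "e x y = e y x" if "?adj x y" for x y
      using pat that unfolding is_pattern_def by blast
    have "(\<Sum>x\<in>S. L / 4 * real (a x) * (1 + ln (real n / real (a x)))) \<le> (\<Sum>x\<in>S. \<Sum>y\<in>{y\<in>S. ?adj x y}. ?I x y)"
      by (intro sum_mono S(3))
    then have "exp (- (\<Sum>x\<in>S. \<Sum>y\<in>{y\<in>S. ?adj x y}. ?I x y) / 2) \<le>
       exp (- (\<Sum>x\<in>S. L / 4 * real (a x) * (1 + ln (real n / real (a x)))) / 2)" by simp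
    also have "\<dots> = exp (\<Sum>x\<in>S. - (L / 8 * real (a x) * (1 + ln (real n / real (a x)))))"
      by (simp add: sum_negf sum_divide_distrib)
    also have "\<dots> = (\<Prod>x\<in>S. exp (- (L / 8 * real (a x) * (1 + ln (real n / real (a x))))))"
      using fin by (rule exp_sum)
    finally have expo: "exp (- (\<Sum>x\<in>S. \<Sum>y\<in>{y\<in>S. ?adj x y}. ?I x y) / 2) \<le>
      (\<Prod>x\<in>S. exp (- (L / 8 * real (a x) * (1 + ln (real n / real (a x))))))" .
    have "prob_found d n h adjH (sub_a S a) (sub_e S e) \<le>
      (\<Prod>x\<in>S. real (n choose a x)) * (\<Prod>x\<in>S. (exp 1 * real (a x)) ^ d) *
      exp (- (\<Sum>x\<in>S. \<Sum>y\<in>{y\<in>S. ?adj x y}. ?I x y) / 2)"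
      using assms(1,2) n fin Sh a e_sym by (intro prob_found_le) (auto simp: Suc_le_eq)
    also have "\<dots> \<le> (\<Prod>x\<in>S. real (n choose a x)) * (\<Prod>x\<in>S. (exp 1 * real (a x)) ^ d) *
      (\<Prod>x\<in>S. exp (- (L / 8 * real (a x) * (1 + ln (real n / real (a x))))))"
      by (intro mult_left_mono expo mult_nonneg_nonneg prod_nonneg) auto
    also have "\<dots> = (\<Prod>x\<in>S. real (n choose a x) * (exp 1 * real (a x)) ^ d *
       exp (- (L / 8 * real (a x) * (1 + ln (real n / real (a x))))))"
      by (simp add: prod.distrib)
    also have "\<dots> \<le> (\<Prod>x\<in>S. c * ?B x powr (1 - L / 10))"
      unfolding c_def using assms a
      by (intro prod_mono conjI vertex_factor_le) (auto intro!: mult_nonneg_nonneg)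
    also have "\<dots> = c ^ card S * (\<Prod>x\<in>S. ?B x) powr (1 - L / 10)"
      by (simp add: prod.distrib prod_powr_distrib)
    also have "\<dots> \<le> c ^ (h * d) * (\<Prod>x\<in>S. real (a x) powr (real d / 4)) * (\<Prod>x\<in>S. ?B x) powr (1 - L / 10)"
    proof (rule mult_right_mono)
      have "card S \<le> h * d"
        using card_mono[OF pattern_finite_supp[OF n pat] S(1)] pattern_card_supp_le[OF n pat] by simp
      then have "c ^ card S \<le> c ^ (h * d)" using c by (rule power_increasing)
      \<comment> \<open>As \<open>a x \<ge> 1\<close> on \<open>S\<close>, each of these powers is
        at least \<open>1\<close>, so bringing in their product preserves the upper bound.\<close>
      moreover have "1 \<le> (\<Prod>x\<in>S. real (a x) powr (real d / 4))"
        using a by (intro prod_ge_1 ge_one_powr_ge_zero) auto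
      ultimately have "c ^ card S * 1 \<le> c ^ (h * d) * (\<Prod>x\<in>S. real (a x) powr (real d / 4))"
        using c by (intro mult_mono) auto
      then show "c ^ card S \<le> c ^ (h * d) * (\<Prod>x\<in>S. real (a x) powr (real d / 4))" by simp
    qed simp
    finally show "\<exists>S \<subseteq> {0..<h} \<times> UNIV.
        potency d n h adjH (sub_a S a) (sub_e S e) \<ge> potency d n h adjH a e - 150 * L * sqrt (real d) \<and>
        prob_found d n h adjH (sub_a S a) (sub_e S e) \<le>
          c ^ (h * d) * (\<Prod>x\<in>{x\<in>S. a x > 0}. real (a x) powr (real d / 4)) *
          (\<Prod>x\<in>{x\<in>S. a x > 0}. real (n choose min (a x) (n div 2))) powr (1 - L / 10)"
      using S(2) Sh filt by (intro exI[of _ S]) simp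
  qed
qed

end
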